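(* Let $(X,\|\cdot\|)$ be an extended normed linear space with finest locally convex topology $\tau_F$, and let $M$ be a linear subspace of $X$ such that $X=X_{fin}\oplus M$ (algebraic direct sum). Let $B_{X^*}=\{f\in X^*:\|f\|_{op}\le 1\}$ and let $\tau_{w^*}$ be the weak$^*$ topology. Then the following statements are equivalent: (1) $(B_{X^*},\tau_{w^*})$ is metrizable; (2) the dimension of $M$ is countable and $(X_{fin},\|\cdot\|)$ is separable; (3) both $(M,\tau_F|_M)$ and $(X_{fin},\|\cdot\|)$ are separable; (4) $(X,\tau_F)$ is separable.
   Context: Vector spaces are over $\mathbb{K}$, where $\mathbb{K}$ is $\mathbb{R}$ or $\mathbb{C}$. An extended norm on $X$ is a map $\|\cdot\|:X\to[0,\infty]$ with $\|x\|=0$ iff $x=0$, $\|\alpha x\|=|\alpha|\|x\|$ (convention $0\cdot\infty=0$) and $\|x+y\|\le\|x\|+\|y\|$. An extended normed linear space (enls) is a vector space with an extended norm, topologized by the metric $d(x,y)=\min\{1,\|x-y\|\}$. $X_{fin}=\{x\in X:\|x\|<\infty\}$. $X^*$ is the set of all continuous linear functionals $X\to\mathbb{K}$, and $\|f\|_{op}=\sup\{|f(x)|:\|x\|\le1\}$ (this is only a seminorm in general). The finest locally convex topology (flc topology) $\tau_F$ is the finest locally convex topology on $X$ (i.e. one induced by finite-valued seminorms) that is coarser than the topology of the extended norm. The weak$^*$ topology $\tau_{w^*}$ on $X^*$ is induced by the seminorms $f\mapsto|f(x)|$, $x\in X$. "Countable" includes finite. *)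

theory Defs
  imports "HOL-Analysis.Analysis"
begin

text \<open>The scalar field: \<open>\<real>\<close> or \<open>\<complex>\<close> with its absolute value, up to isometric field isomorphism.\<close>

class real_or_complex = real_normed_field +
  assumes real_or_complex:
    "\<exists>\<phi> :: 'a \<Rightarrow> complex. (\<forall>a b. \<phi> (a + b) = \<phi> a + \<phi> b) \<and> (\<forall>r a. \<phi> (r *\<^sub>R a) = r *\<^sub>R \<phi> a) \<and>
       (\<forall>a b. \<phi> (a * b) = \<phi> a * \<phi> b) \<and> (\<forall>a. norm (\<phi> a) = norm a) \<and> (range \<phi> = \<real> \<or> range \<phi> = UNIV)"

instance real :: real_or_complex
proof
  show "\<exists>\<phi> :: real \<Rightarrow> complex. (\<forall>a b. \<phi> (a + b) = \<phi> a + \<phi> b) \<and> (\<forall>r a. \<phi> (r *\<^sub>R a) = r *\<^sub>R \<phi> a) \<and>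
       (\<forall>a b. \<phi> (a * b) = \<phi> a * \<phi> b) \<and> (\<forall>a. norm (\<phi> a) = norm a) \<and> (range \<phi> = \<real> \<or> range \<phi> = UNIV)"
    by (intro exI[of _ complex_of_real]) (simp add: Reals_def scaleR_conv_of_real)
qed

instance complex :: real_or_complex
  by standard (rule exI[of _ "\<lambda>z. z"], simp)

text \<open>In \<^typ>\<open>ennreal\<close> we have \<open>0 * \<infinity> = 0\<close>, so the scaling law below also covers the scalar \<open>0\<close>.\<close>

locale extended_normed_space = vector_space smul
  for smul :: "'k::real_or_complex \<Rightarrow> 'x::ab_group_add \<Rightarrow> 'x" +
  fixes enorm :: "'x \<Rightarrow> ennreal"
  assumes enorm_eq_0_iff: "enorm x = 0 \<longleftrightarrow> x = 0"
    and enorm_scale: "enorm (smul a x) = ennreal (norm a) * enorm x"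
    and enorm_triangle: "enorm (x + y) \<le> enorm x + enorm y"

definition enorm_dist :: "('x::ab_group_add \<Rightarrow> ennreal) \<Rightarrow> 'x \<Rightarrow> 'x \<Rightarrow> real" where
  "enorm_dist enorm x y = enn2real (min 1 (enorm (x - y)))"

definition enorm_topology :: "'x set \<Rightarrow> ('x::ab_group_add \<Rightarrow> ennreal) \<Rightarrow> 'x topology" where
  "enorm_topology V enorm = Metric_space.mtopology V (enorm_dist enorm)"

definition fin_subspace :: "('x \<Rightarrow> ennreal) \<Rightarrow> 'x set" where
  "fin_subspace enorm = {x. enorm x < \<infinity>}"

definition dual_space ::
  "('k::real_or_complex \<Rightarrow> 'x::ab_group_add \<Rightarrow> 'x) \<Rightarrow> ('x \<Rightarrow> ennreal) \<Rightarrow> ('x \<Rightarrow> 'k) set" where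
  "dual_space smul enorm =
     {f. Vector_Spaces.linear smul (*) f \<and> continuous_map (enorm_topology UNIV enorm) euclidean f}"

definition op_norm :: "('x \<Rightarrow> ennreal) \<Rightarrow> ('x \<Rightarrow> 'k::real_or_complex) \<Rightarrow> ennreal" where
  "op_norm enorm f = (SUP x\<in>{x. enorm x \<le> 1}. ennreal (norm (f x)))"

definition dual_unit_ball ::
  "('k::real_or_complex \<Rightarrow> 'x::ab_group_add \<Rightarrow> 'x) \<Rightarrow> ('x \<Rightarrow> ennreal) \<Rightarrow> ('x \<Rightarrow> 'k) set" where
  "dual_unit_ball smul enorm = {f \<in> dual_space smul enorm. op_norm enorm f \<le> 1}"

definition seminorm :: "('k::real_or_complex \<Rightarrow> 'x::ab_group_add \<Rightarrow> 'x) \<Rightarrow> ('x \<Rightarrow> real) \<Rightarrow> bool" where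
  "seminorm smul p \<longleftrightarrow> (\<forall>x. 0 \<le> p x) \<and> (\<forall>a x. p (smul a x) = norm a * p x) \<and>
     (\<forall>x y. p (x + y) \<le> p x + p y)"

text \<open>The topology induced on \<open>V\<close> by a family of seminorms has the balls of the single seminorms as
  a subbase; \<open>V\<close> itself is added so that an empty family gives the indiscrete topology on \<open>V\<close>.\<close>

definition seminorm_topology :: "'v::minus set \<Rightarrow> ('v \<Rightarrow> real) set \<Rightarrow> 'v topology" where
  "seminorm_topology V P =
     topology_generated_by (insert V {{y \<in> V. p (y - x) < e} | p x e. p \<in> P \<and> x \<in> V \<and> 0 < e})"

definition weak_star_topology ::
  "('k::real_or_complex \<Rightarrow> 'x::ab_group_add \<Rightarrow> 'x) \<Rightarrow> ('x \<Rightarrow> ennreal) \<Rightarrow> ('x \<Rightarrow> 'k) topology" where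
  "weak_star_topology smul enorm =
     seminorm_topology (dual_space smul enorm) (range (\<lambda>x f. norm (f x)))"

definition locally_convex_topology ::
  "('k::real_or_complex \<Rightarrow> 'x::ab_group_add \<Rightarrow> 'x) \<Rightarrow> 'x topology \<Rightarrow> bool" where
  "locally_convex_topology smul T \<longleftrightarrow>
     (\<exists>P. (\<forall>p\<in>P. seminorm smul p) \<and> T = seminorm_topology UNIV P)"

definition coarser_topology :: "'a topology \<Rightarrow> 'a topology \<Rightarrow> bool" where
  "coarser_topology T T' \<longleftrightarrow> topspace T = topspace T' \<and> (\<forall>U. openin T U \<longrightarrow> openin T' U)"

definition is_flc_topology ::
  "('k::real_or_complex \<Rightarrow> 'x::ab_group_add \<Rightarrow> 'x) \<Rightarrow> ('x \<Rightarrow> ennreal) \<Rightarrow> 'x topology \<Rightarrow> bool" where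
  "is_flc_topology smul enorm T \<longleftrightarrow>
     locally_convex_topology smul T \<and> coarser_topology T (enorm_topology UNIV enorm) \<and>
     (\<forall>T'. locally_convex_topology smul T' \<and> coarser_topology T' (enorm_topology UNIV enorm)
        \<longrightarrow> coarser_topology T' T)"

text \<open>The description is proper: see \<open>is_flc_topology_flc_topology\<close> below.\<close>

definition flc_topology ::
  "('k::real_or_complex \<Rightarrow> 'x::ab_group_add \<Rightarrow> 'x) \<Rightarrow> ('x \<Rightarrow> ennreal) \<Rightarrow> 'x topology" where
  "flc_topology smul enorm = (THE T. is_flc_topology smul enorm T)"

text \<open>The library's \<open>dim\<close> is \<open>0\<close> on infinite-dimensional subspaces, so it cannot be used here.\<close>

definition countable_dim :: "('k::field \<Rightarrow> 'x::ab_group_add \<Rightarrow> 'x) \<Rightarrow> 'x set \<Rightarrow> bool" where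
  "countable_dim smul M \<longleftrightarrow>
     (\<exists>B. \<not> module.dependent smul B \<and> module.span smul B = M \<and> countable B)"

definition direct_sum_decomposition ::
  "('k::field \<Rightarrow> 'x::ab_group_add \<Rightarrow> 'x) \<Rightarrow> 'x set \<Rightarrow> 'x set \<Rightarrow> bool" where
  "direct_sum_decomposition smul V W \<longleftrightarrow>
     module.subspace smul V \<and> module.subspace smul W \<and>
     V \<inter> W = {0} \<and> {v + w | v w. v \<in> V \<and> w \<in> W} = UNIV"

context extended_normed_space
begin

lemma enorm_zero: "enorm 0 = 0"
  by (simp add: enorm_eq_0_iff)

lemma enorm_minus: "enorm (- x) = enorm x"
  using enorm_scale[of "- 1" x] by simp

lemma enorm_dist_ennreal: "ennreal (enorm_dist enorm x y) = min 1 (enorm (x - y))"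
  by (simp add: enorm_dist_def ennreal_enn2real_if min_def)

lemma Metric_space_enorm_dist: "Metric_space V (enorm_dist enorm)"
proof
  fix x y z
  show "0 \<le> enorm_dist enorm x y"
    by (simp add: enorm_dist_def)
  then have nn: "\<And>x y. 0 \<le> enorm_dist enorm x y"
    by (simp add: enorm_dist_def)
  show "enorm_dist enorm x y = enorm_dist enorm y x"
    using enorm_minus[of "x - y"] by (simp add: enorm_dist_def)
  have "enorm_dist enorm x y = 0 \<longleftrightarrow> ennreal (enorm_dist enorm x y) = 0"
    using nn[of x y] by (simp add: ennreal_eq_0_iff)
  also have "\<dots> \<longleftrightarrow> x = y"
    unfolding enorm_dist_ennreal by (auto simp: min_def enorm_eq_0_iff enorm_zero split: if_splits)
  finally show "enorm_dist enorm x y = 0 \<longleftrightarrow> x = y" .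
  have "enorm (x - z) \<le> enorm (x - y) + enorm (y - z)"
    using enorm_triangle[of "x - y" "y - z"] by simp
  then have "min 1 (enorm (x - z)) \<le> min 1 (enorm (x - y)) + min 1 (enorm (y - z))"
    by (auto simp: min_def add_increasing add_increasing2 intro: order_trans)
  then show "enorm_dist enorm x z \<le> enorm_dist enorm x y + enorm_dist enorm y z"
    by (metis enorm_dist_ennreal nn add_nonneg_nonneg ennreal_le_iff ennreal_plus)
qed

lemma topspace_enorm_topology: "topspace (enorm_topology V enorm) = V"
proof -
  interpret Metric_space V "enorm_dist enorm"
    by (rule Metric_space_enorm_dist)
  show ?thesis
    unfolding enorm_topology_def by simp
qed

lemma subspace_fin_subspace: "subspace (fin_subspace enorm)"
proof (rule subspaceI)
  show "0 \<in> fin_subspace enorm"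
    by (simp add: fin_subspace_def enorm_zero)
  fix x y c
  assume x: "x \<in> fin_subspace enorm"
  then show "smul c x \<in> fin_subspace enorm"
    by (simp add: fin_subspace_def enorm_scale ennreal_mult_less_top)
  assume "y \<in> fin_subspace enorm"
  with x show "x + y \<in> fin_subspace enorm"
    using enorm_triangle[of x y] by (auto simp: fin_subspace_def intro: le_less_trans)
qed

lemma is_flc_topology_unique:
  assumes "is_flc_topology smul enorm T" "is_flc_topology smul enorm T'"
  shows "T = T'"
  using assms unfolding is_flc_topology_def coarser_topology_def by (meson topology_eq)

lemma is_flc_topology_exists: "\<exists>T. is_flc_topology smul enorm T"
proof -
  let ?X = "enorm_topology UNIV enorm"
  define P where "P = {p. seminorm smul p \<and>
    (\<forall>x e. 0 < e \<longrightarrow> openin ?X {y. p (y - x) < e})}"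
  let ?T = "seminorm_topology UNIV P"
  have top: "topspace (seminorm_topology UNIV Q) = UNIV" for Q :: "('x \<Rightarrow> real) set"
    by (auto simp: seminorm_topology_def)
  have topX: "topspace ?X = UNIV"
    by (rule topspace_enorm_topology)
  have "openin ?X U" if "openin ?T U" for U
  proof -
    have "generate_topology_on
        (insert UNIV {{y \<in> UNIV. p (y - x) < e} | p x e. p \<in> P \<and> x \<in> UNIV \<and> 0 < e}) U"
      using that unfolding seminorm_topology_def openin_topology_generated_by_iff .
    then show ?thesis
    proof (rule generate_topology_on_coarsest[OF istopology_openin, rotated])
      fix S
      assume "S \<in> insert UNIV {{y \<in> UNIV. p (y - x) < e} | p x e. p \<in> P \<and> x \<in> UNIV \<and> 0 < e}"
      then show "openin ?X S"
        using openin_topspace[of ?X] unfolding topX P_def by auto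
    qed
  qed
  then have "coarser_topology ?T ?X"
    by (simp add: coarser_topology_def top topX)
  moreover have "locally_convex_topology smul ?T"
    unfolding locally_convex_topology_def by (rule exI[of _ P]) (auto simp: P_def)
  moreover have "coarser_topology T' ?T"
    if lc: "locally_convex_topology smul T'" and co: "coarser_topology T' ?X" for T'
  proof -
    obtain Q where Q: "\<And>p. p \<in> Q \<Longrightarrow> seminorm smul p" and T': "T' = seminorm_topology UNIV Q"
      using lc unfolding locally_convex_topology_def by blast
    have "Q \<subseteq> P"
    proof
      fix p assume p: "p \<in> Q"
      have "openin T' {y. p (y - x) < e}" if "0 < e" for x e
        unfolding T' seminorm_topology_def
        by (rule topology_generated_by_Basis) (use p that in auto)
      then show "p \<in> P"
        using co Q[OF p] unfolding P_def coarser_topology_def by blast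
    qed
    then have sub: "insert UNIV {{y \<in> UNIV. p (y - x) < e} | p x e. p \<in> Q \<and> x \<in> UNIV \<and> 0 < e}
        \<subseteq> insert UNIV {{y \<in> UNIV. p (y - x) < e} | p x e. p \<in> P \<and> x \<in> UNIV \<and> 0 < e}"
      by blast
    have "openin ?T U" if "openin T' U" for U
    proof -
      have "generate_topology_on
          (insert UNIV {{y \<in> UNIV. p (y - x) < e} | p x e. p \<in> Q \<and> x \<in> UNIV \<and> 0 < e}) U"
        using that unfolding T' seminorm_topology_def openin_topology_generated_by_iff .
      then show ?thesis
      proof (rule generate_topology_on_coarsest[OF istopology_openin, rotated])
        fix S
        assume "S \<in> insert UNIV {{y \<in> UNIV. p (y - x) < e} | p x e. p \<in> Q \<and> x \<in> UNIV \<and> 0 < e}"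
        then show "openin ?T S"
          unfolding seminorm_topology_def
          using sub by (intro topology_generated_by_Basis) (rule subsetD)
      qed
    qed
    then show ?thesis
      by (simp add: coarser_topology_def top T')
  qed
  ultimately show ?thesis
    unfolding is_flc_topology_def by blast
qed

lemma is_flc_topology_flc_topology: "is_flc_topology smul enorm (flc_topology smul enorm)"
  unfolding flc_topology_def
  by (rule theI') (use is_flc_topology_exists is_flc_topology_unique in blast)

end

end

theory Submission
  imports Defs
begin

text \<open>
  The four statements are linked in a cycle: metrizability of the dual ball gives separability of
  \<open>\<tau>\<^sub>F\<close>, which gives separability of both summands, which gives countable dimension of \<open>M\<close>, which together
  with separability of \<open>X\<^sub>f\<^sub>i\<^sub>n\<close> gives back metrizability.

  Everything rests on two concrete descriptions. A set is \<open>\<tau>\<^sub>F\<close>-open iff around each of its points it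
  contains a ball of a seminorm \<open>p\<close> with \<open>p \<le> c \<parallel>\<cdot>\<parallel>\<close> for some \<open>c > 0\<close>
  (\<open>openin_flc_topology\<close>); such a \<open>p\<close> is controlled by the norm on \<open>X\<^sub>f\<^sub>i\<^sub>n\<close> and is
  arbitrary on \<open>M\<close>. The dual ball consists of the linear functionals with \<open>\<bar>f\<bar> \<le> \<parallel>\<cdot>\<parallel>\<close>
  (\<open>mem_dual_ball_iff\<close>); again there is no restriction on \<open>M\<close>.

  If the ball is metrizable, a countable base of neighbourhoods of \<open>0\<close> involves only countably many
  points of \<open>X\<close>, and a functional in the ball vanishing at all of them is \<open>0\<close>
  (\<open>metrizable_imp_countable_total\<close>). By the Hahn-Banach theorem the span of these points is
  \<open>\<tau>\<^sub>F\<close>-dense (\<open>total_imp_span_dense\<close>), and then so is the countable set of combinations with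
  coefficients from a countable dense set of scalars.

  The projections to \<open>X\<^sub>f\<^sub>i\<^sub>n\<close> and \<open>M\<close> are continuous from \<open>\<tau>\<^sub>F\<close>, so separability passes to both summands
  (\<open>separable_flc_topology_summands\<close>). On \<open>M\<close> every linear functional is continuous, hence every
  subspace of \<open>M\<close> is closed and a countable dense set must span \<open>M\<close>
  (\<open>separable_flc_topology_imp_countable_dim\<close>).

  Finally, the values of a functional in the ball on a dense subset of \<open>X\<^sub>f\<^sub>i\<^sub>n\<close> and on a basis of \<open>M\<close>
  determine the functional, even uniformly continuously at each point of \<open>X\<close>. If both sets are
  countable, the ball embeds into a countable power of the scalar field
  (\<open>uniformly_determined_imp_metrizable\<close>).

  The Hahn-Banach theorem is proved by minimizing sublinear functionals: a minimal one is linear.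
\<close>

section \<open>The scalar field\<close>

text \<open>The two cases of the scalar field are treated together: \<open>j\<close> is an imaginary unit when the field is
  complex and is \<open>0\<close> when it is real. Every formula below that decomposes scalars as
  \<open>r + j s\<close>, in particular the complexification in the Hahn-Banach theorem, is valid for both
  values of \<open>j\<close>.\<close>

lemma real_or_complex_imaginary_unit:
  obtains j :: "'k::real_or_complex"
  where "j = 0 \<or> j * j = - 1" "\<And>a :: 'k. \<exists>r s. a = of_real r + j * of_real s"
proof -
  obtain \<phi> :: "'k \<Rightarrow> complex" where add: "\<And>a b. \<phi> (a + b) = \<phi> a + \<phi> b"
    and scale: "\<And>r a. \<phi> (r *\<^sub>R a) = r *\<^sub>R \<phi> a" and mult: "\<And>a b. \<phi> (a * b) = \<phi> a * \<phi> b"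
    and norm: "\<And>a. norm (\<phi> a) = norm a" and rng: "range \<phi> = \<real> \<or> range \<phi> = UNIV"
    using real_or_complex by metis
  have "\<phi> 1 * \<phi> 1 = \<phi> 1" "norm (\<phi> 1) = 1"
    using mult[of 1 1] norm[of 1] by auto
  then have one: "\<phi> 1 = 1"
    by (metis mult_cancel_right1 norm_zero zero_neq_one)
  have real: "\<phi> (of_real r) = of_real r" for r
    using scale[of r 1] one by (simp add: of_real_def)
  have diff: "\<phi> (a - b) = \<phi> a - \<phi> b" for a b
    using add[of "a - b" b] by simp
  have inj: "a = b" if "\<phi> a = \<phi> b" for a b
    using diff[of a b] norm[of "a - b"] that by simp
  show ?thesis
  proof (cases "range \<phi> = \<real>")
    case True
    have "\<exists>r s. a = of_real r + 0 * of_real s" for a :: 'k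
    proof -
      have "\<phi> a \<in> \<real>"
        using True by auto
      then obtain r where "\<phi> a = \<phi> (of_real r)"
        by (auto simp: real elim: Reals_cases)
      then show ?thesis
        using inj by auto
    qed
    then show ?thesis
      by (intro that[of 0]) auto
  next
    case False
    then obtain j where j: "\<phi> j = \<i>"
      using rng by (metis rangeE UNIV_I)
    have "\<phi> (j * j) = \<phi> (of_real (- 1))"
      unfolding mult j real by simp
    then have "j * j = - 1"
      using inj by fastforce
    moreover have "\<exists>r s. a = of_real r + j * of_real s" for a
    proof -
      have "\<phi> a = \<phi> (of_real (Re (\<phi> a)) + j * of_real (Im (\<phi> a)))"
        unfolding add mult real j by (rule complex_eq)
      then show ?thesis
        using inj by blast
    qed
    ultimately show ?thesis
      by (intro that[of j]) auto
  qed
qed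

lemma countable_dense_scalars:
  obtains Q :: "'k::real_or_complex set"
  where "countable Q" "\<And>a e. 0 < e \<Longrightarrow> \<exists>q\<in>Q. norm (a - q) < e"
proof -
  obtain j :: 'k where j: "j = 0 \<or> j * j = - 1" "\<And>a :: 'k. \<exists>r s. a = of_real r + j * of_real s"
    using real_or_complex_imaginary_unit by blast
  have "norm j * norm j \<le> 1"
    using j(1) by (auto simp flip: norm_mult)
  then have nj: "norm j \<le> 1"
    by (metis abs_norm_cancel abs_square_le_1 power2_eq_square)
  define Q where "Q = (\<lambda>(r, s). of_real r + j * of_real s) ` (\<rat> \<times> \<rat>)"
  have "countable Q"
    unfolding Q_def by (intro countable_image countable_SIGMA countable_rat)
  moreover have "\<exists>q\<in>Q. norm (a - q) < e" if e: "0 < e" for a e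
  proof -
    obtain r s where a: "a = of_real r + j * of_real s"
      using j(2) by blast
    obtain r' s' where r': "r' \<in> \<rat>" "r < r'" "r' < r + e / 2" and s': "s' \<in> \<rat>" "s < s'" "s' < s + e / 2"
      using Rats_dense_in_real[of r "r + e / 2"] Rats_dense_in_real[of s "s + e / 2"] e by auto
    have "a - (of_real r' + j * of_real s') = of_real (r - r') + j * of_real (s - s')"
      by (simp add: a algebra_simps)
    also have "norm \<dots> \<le> \<bar>r - r'\<bar> + norm j * \<bar>s - s'\<bar>"
      by (metis norm_mult norm_of_real norm_triangle_ineq)
    also have "\<dots> \<le> \<bar>r - r'\<bar> + \<bar>s - s'\<bar>"
      using nj by (simp add: mult_left_le_one_le)
    also have "\<dots> < e"
      using r' s' by linarith
    finally show ?thesis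
      using r' s' by (auto simp: Q_def)
  qed
  ultimately show ?thesis
    by (rule that)
qed

section \<open>The Hahn-Banach theorem\<close>

locale real_or_complex_space = vector_space smul
  for smul :: "'k::real_or_complex \<Rightarrow> 'x::ab_group_add \<Rightarrow> 'x"
begin

abbreviation rsmul :: "real \<Rightarrow> 'x \<Rightarrow> 'x" where
  "rsmul t \<equiv> smul (of_real t)"

text \<open>Homogeneity is only required as an inequality for positive factors; applying the inequality to
  \<open>t\<close> and to \<open>1 / t\<close> gives equality, and at \<open>0\<close> it forces the value \<open>0\<close>.\<close>

definition sublinear :: "('x \<Rightarrow> real) \<Rightarrow> bool" where
  "sublinear p \<longleftrightarrow> (\<forall>x y. p (x + y) \<le> p x + p y) \<and> (\<forall>t>0. \<forall>x. p (rsmul t x) \<le> t * p x)"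

lemma sublinear_add: "sublinear p \<Longrightarrow> p (x + y) \<le> p x + p y"
  by (simp add: sublinear_def)

lemma sublinear_scale:
  assumes "sublinear p" "0 < t"
  shows "p (rsmul t x) = t * p x"
proof -
  have "0 < inverse t"
    using assms by simp
  then have "p (rsmul (inverse t) (rsmul t x)) \<le> inverse t * p (rsmul t x)"
    using assms(1) unfolding sublinear_def by blast
  then have "t * p x \<le> p (rsmul t x)"
    using assms by (simp add: field_simps)
  then show ?thesis
    using assms by (simp add: sublinear_def order_antisym)
qed

lemma sublinear_zero: "sublinear p \<Longrightarrow> p 0 = 0"
  using sublinear_scale[of p 2 0] by simp

lemma sublinear_minus: "sublinear p \<Longrightarrow> - p (- x) \<le> p x"
  using sublinear_add[of p x "- x"] by (simp add: sublinear_zero)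

text \<open>The largest sublinear functional below \<open>p\<close> whose value at \<open>- x\<close> is at most \<open>- p x\<close>. It serves twice.
  A minimal sublinear functional coincides with all its shifts, which makes it additive; and shifting
  the given bound before minimizing fixes the value of the resulting linear functional at \<open>x\<close>.\<close>

definition sublinear_shift :: "'x \<Rightarrow> ('x \<Rightarrow> real) \<Rightarrow> 'x \<Rightarrow> real" where
  "sublinear_shift x p y = (INF t\<in>{0..}. p (y + rsmul t x) - t * p x)"

lemma sublinear_shift_le:
  assumes p: "sublinear p" and t: "0 \<le> t"
  shows "sublinear_shift x p y \<le> p (y + rsmul t x) - t * p x"
  unfolding sublinear_shift_def
proof (rule cINF_lower)
  show "bdd_below ((\<lambda>t. p (y + rsmul t x) - t * p x) ` {0..})"
  proof (rule bdd_belowI2)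
    fix t :: real assume "t \<in> {0..}"
    then have "p (rsmul t x) = t * p x"
      using sublinear_scale[OF p, of t x] sublinear_zero[OF p] by (cases "t = 0") auto
    then show "- p (- y) \<le> p (y + rsmul t x) - t * p x"
      using sublinear_add[OF p, of "y + rsmul t x" "- y"] by simp
  qed
qed (use t in simp)

lemma sublinear_sublinear_shift:
  assumes p: "sublinear p"
  shows "sublinear (sublinear_shift x p)"
proof -
  have ne: "{0::real..} \<noteq> {}"
    by auto
  note lower = sublinear_shift_le[OF p]
  have "sublinear_shift x p (y + z) \<le> sublinear_shift x p y + sublinear_shift x p z" for y z
  proof -
    have *: "sublinear_shift x p (y + z) \<le> (p (y + rsmul s x) - s * p x) + (p (z + rsmul t x) - t * p x)"
      if "0 \<le> s" "0 \<le> t" for s t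
    proof -
      have "p (y + z + rsmul (s + t) x) \<le> p (y + rsmul s x) + p (z + rsmul t x)"
        using sublinear_add[OF p, of "y + rsmul s x" "z + rsmul t x"]
        by (simp add: scale_left_distrib algebra_simps)
      then show ?thesis
        using lower[of "s + t" x "y + z"] that by (simp add: algebra_simps)
    qed
    have "sublinear_shift x p (y + z) - (p (z + rsmul t x) - t * p x) \<le> sublinear_shift x p y"
      if "0 \<le> t" for t
      unfolding sublinear_shift_def[of x p y]
      by (rule cINF_greatest[OF ne]) (use *[OF _ that] in \<open>fastforce simp: algebra_simps\<close>)
    then have "sublinear_shift x p (y + z) - sublinear_shift x p y \<le> sublinear_shift x p z"
      unfolding sublinear_shift_def[of x p z]
      by (intro cINF_greatest[OF ne]) (force simp: algebra_simps)
    then show ?thesis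
      by simp
  qed
  moreover have "sublinear_shift x p (rsmul c y) \<le> c * sublinear_shift x p y" if c: "0 < c" for c y
  proof -
    have "sublinear_shift x p (rsmul c y) / c \<le> p (y + rsmul t x) - t * p x" if t: "0 \<le> t" for t
    proof -
      have "p (rsmul c y + rsmul (c * t) x) = c * p (y + rsmul t x)"
        using sublinear_scale[OF p c, of "y + rsmul t x"] by (simp add: scale_right_distrib)
      then show ?thesis
        using lower[of "c * t" x "rsmul c y"] t c by (simp add: field_simps)
    qed
    then have "sublinear_shift x p (rsmul c y) / c \<le> sublinear_shift x p y"
      unfolding sublinear_shift_def[of x p y] by (intro cINF_greatest[OF ne]) auto
    then show ?thesis
      using c by (simp add: field_simps)
  qed
  ultimately show ?thesis
    by (simp add: sublinear_def)
qed

text \<open>The pointwise infimum of a chain is again sublinear: of two members used to estimate the two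
  summands, the smaller one estimates both. This is the hypothesis of Zorn's lemma below.\<close>

lemma sublinear_chain_bound:
  assumes sub: "\<And>p. p \<in> C \<Longrightarrow> sublinear p \<and> p \<le> q" and q: "sublinear q"
    and chain: "\<And>p p'. p \<in> C \<Longrightarrow> p' \<in> C \<Longrightarrow> p \<le> p' \<or> p' \<le> p"
  obtains u where "sublinear u" "u \<le> q" "\<And>p. p \<in> C \<Longrightarrow> u \<le> p"
proof (cases "C = {}")
  case True
  then show ?thesis
    using that[of q] q by simp
next
  case ne: False
  define u where "u = (\<lambda>x. INF p\<in>C. p x)"
  (* All members lie below q, so p x >= - p (- x) >= - q (- x) bounds the chain from below. *)
  have "- q (- x) \<le> p x" if "p \<in> C" for p x
    using sublinear_minus[of p x] sub[OF that] le_funD[of p q "- x"] by auto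
  then have "bdd_below ((\<lambda>p. p x) ` C)" for x
    by (intro bdd_belowI2)
  then have lower: "u x \<le> p x" if "p \<in> C" for p x
    unfolding u_def using that by (rule cINF_lower)
  have "u (x + y) \<le> u x + u y" for x y
  proof -
    have *: "u (x + y) \<le> p x + p' y" if "p \<in> C" "p' \<in> C" for p p'
    proof (cases "p \<le> p'")
      case True
      then show ?thesis
        using lower[OF that(1), of "x + y"] sub[OF that(1)] sublinear_add[of p x y]
        by (smt (verit) le_funD)
    next
      case False
      then have "p' \<le> p"
        using chain that by blast
      then show ?thesis
        using lower[OF that(2), of "x + y"] sub[OF that(2)] sublinear_add[of p' x y]
        by (smt (verit) le_funD)
    qed
    have "u (x + y) - p' y \<le> u x" if "p' \<in> C" for p'
      unfolding u_def[THEN fun_cong, of x]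
      by (rule cINF_greatest[OF ne]) (use *[OF _ that] in \<open>fastforce simp: algebra_simps\<close>)
    then have "u (x + y) - u x \<le> u y"
      unfolding u_def[THEN fun_cong, of y] by (intro cINF_greatest[OF ne]) (force simp: algebra_simps)
    then show ?thesis
      by simp
  qed
  moreover have "u (rsmul t x) \<le> t * u x" if t: "0 < t" for t x
  proof -
    have "u (rsmul t x) / t \<le> p x" if "p \<in> C" for p
      using lower[OF that, of "rsmul t x"] sublinear_scale[of p t x] sub[OF that] t
      by (simp add: field_simps)
    then have "u (rsmul t x) / t \<le> u x"
      unfolding u_def[THEN fun_cong, of x] by (intro cINF_greatest[OF ne])
    then show ?thesis
      using t by (simp add: field_simps)
  qed
  ultimately have "sublinear u"
    by (simp add: sublinear_def)
  moreover have "u \<le> q"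
  proof (rule le_funI)
    fix x
    obtain p where "p \<in> C"
      using ne by blast
    then show "u x \<le> q x"
      using lower[of p x] sub[of p] by (auto simp: le_fun_def intro: order_trans)
  qed
  ultimately show ?thesis
    by (rule that) (rule le_funI, rule lower)
qed

text \<open>Minimizing among sublinear functionals replaces the usual extension of functionals from larger and
  larger subspaces, so no partially defined functionals occur.\<close>

lemma minimal_sublinear:
  assumes q: "sublinear q"
  obtains u where "sublinear u" "u \<le> q" "\<And>p. sublinear p \<Longrightarrow> p \<le> u \<Longrightarrow> p = u"
proof -
  define A where "A = {p. sublinear p \<and> p \<le> q}"
  have "\<exists>m\<in>A. \<forall>a\<in>A. a \<le> m \<longrightarrow> a = m"
  proof (rule predicate_Zorn[where P = "\<lambda>p p'. p' \<le> p"])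
    show "partial_order_on A (relation_of (\<lambda>p p'. p' \<le> p) A)"
      by (rule partial_order_on_relation_ofI) (auto intro: order_trans)
    fix C assume "C \<in> Chains (relation_of (\<lambda>p p'. p' \<le> p) A)"
    then have C: "p \<in> A \<and> p' \<in> A \<and> (p \<le> p' \<or> p' \<le> p)" if "p \<in> C" "p' \<in> C" for p p'
      using that unfolding Chains_def relation_of_def by auto
    have sub: "sublinear p \<and> p \<le> q" if "p \<in> C" for p
      using C[OF that that] by (simp add: A_def)
    have chain: "p \<le> p' \<or> p' \<le> p" if "p \<in> C" "p' \<in> C" for p p'
      using C[OF that] by simp
    obtain u where "sublinear u" "u \<le> q" "\<And>p. p \<in> C \<Longrightarrow> u \<le> p"
      using sublinear_chain_bound[OF sub q chain] by blast
    then show "\<exists>u\<in>A. \<forall>a\<in>C. u \<le> a"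
      unfolding A_def by blast
  qed
  then obtain m where m: "sublinear m" "m \<le> q" "\<And>p. sublinear p \<Longrightarrow> p \<le> q \<Longrightarrow> p \<le> m \<Longrightarrow> p = m"
    unfolding A_def by blast
  show ?thesis
  proof (rule that[OF m(1,2)])
    fix p assume "sublinear p" "p \<le> m"
    then show "p = m"
      using m(2,3) order_trans by metis
  qed
qed

text \<open>By minimality \<open>u\<close> equals its shift, hence \<open>u y \<le> u (y + x) - u x\<close>, the missing half of additivity.\<close>

lemma minimal_sublinear_real_linear:
  assumes u: "sublinear u" and min: "\<And>p. sublinear p \<Longrightarrow> p \<le> u \<Longrightarrow> p = u"
  shows "u (x + y) = u x + u y" and "u (rsmul t x) = t * u x"
proof -
  have add: "u (x + y) = u x + u y" for x y
  proof -
    have "sublinear_shift x u \<le> u"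
      using sublinear_shift_le[OF u, of 0] by (simp add: le_fun_def)
    then have "sublinear_shift x u = u"
      by (intro min sublinear_sublinear_shift u)
    then have "u y \<le> u (y + x) - u x"
      using sublinear_shift_le[OF u, of 1 x y] by simp
    then show ?thesis
      using sublinear_add[OF u, of x y] by (simp add: add.commute)
  qed
  then show "u (x + y) = u x + u y" .
  have neg: "u (- x) = - u x" for x
    using add[of x "- x"] sublinear_zero[OF u] by simp
  consider "0 < t" | "t = 0" | "0 < - t"
    by linarith
  then show "u (rsmul t x) = t * u x"
  proof cases
    case 3
    then have "u (rsmul (- t) x) = - t * u x"
      by (rule sublinear_scale[OF u])
    then show ?thesis
      by (simp add: scale_minus_left neg)
  qed (simp_all add: sublinear_scale[OF u] sublinear_zero[OF u])
qed

lemma real_Hahn_Banach: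
  assumes q: "sublinear q"
  obtains u where "\<And>x y. u (x + y) = u x + u y" "\<And>t x. u (rsmul t x) = t * u x"
    "\<And>x. u x \<le> q x" "u x0 = q x0"
proof -
  obtain u where u: "sublinear u" "u \<le> sublinear_shift x0 q"
    and min: "\<And>p. sublinear p \<Longrightarrow> p \<le> u \<Longrightarrow> p = u"
    using minimal_sublinear[OF sublinear_sublinear_shift[OF q]] by blast
  note lin = minimal_sublinear_real_linear[OF u(1) min]
  have le: "u x \<le> q x" for x
    using sublinear_shift_le[OF q, of 0 x0 x] u(2) by (auto simp: le_fun_def intro: order_trans)
  have "u (- x0) \<le> - q x0"
    using sublinear_shift_le[OF q, of 1 x0 "- x0"] u(2) sublinear_zero[OF q]
    by (auto simp: le_fun_def intro: order_trans)
  moreover have "u (- x0) = - u x0"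
    using lin(2)[of "- 1" x0] by simp
  ultimately have "u x0 = q x0"
    using le[of x0] by linarith
  with lin le show ?thesis
    by (rule that)
qed

lemma vector_space_scalars: "vector_space ((*) :: 'k \<Rightarrow> 'k \<Rightarrow> 'k)"
  by unfold_locales (simp_all add: algebra_simps)

lemma linear_functionalI:
  fixes f :: "'x \<Rightarrow> 'k"
  assumes "\<And>x y. f (x + y) = f x + f y" "\<And>a x. f (smul a x) = a * f x"
  shows "Vector_Spaces.linear smul (*) f"
  unfolding Vector_Spaces.linear_iff using assms vector_space_scalars vector_space_axioms by blast

lemma linear_functionalD:
  fixes f :: "'x \<Rightarrow> 'k"
  assumes "Vector_Spaces.linear smul (*) f"
  shows "f (x + y) = f x + f y" "f (smul a x) = a * f x" "f 0 = 0" "f (x - y) = f x - f y"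
proof -
  have add: "f (x + y) = f x + f y" and scale: "f (smul a x) = a * f x" for x y a
    using assms unfolding Vector_Spaces.linear_iff by blast+
  show "f (x + y) = f x + f y" "f (smul a x) = a * f x"
    by (rule add scale)+
  show "f 0 = 0"
    using scale[of 0 0] by simp
  show "f (x - y) = f x - f y"
    using add[of "x - y" y] by simp
qed

lemma
  assumes "seminorm smul p"
  shows seminorm_nonneg: "0 \<le> p x" and seminorm_scale: "p (smul a x) = norm a * p x"
    and seminorm_add: "p (x + y) \<le> p x + p y"
  using assms by (auto simp: seminorm_def)

lemma seminorm_zero: "seminorm smul p \<Longrightarrow> p 0 = 0"
  using seminorm_scale[of p 0 0] by simp

lemma seminorm_minus: "seminorm smul p \<Longrightarrow> p (- x) = p x"
  using seminorm_scale[of p "- 1" x] by simp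

lemma seminorm_triangle: "seminorm smul p \<Longrightarrow> p (x - z) \<le> p (x - y) + p (y - z)"
  using seminorm_add[of p "x - y" "y - z"] by simp

text \<open>From a real-linear \<open>u\<close> below \<open>q\<close> one gets the scalar-linear functional \<open>u x - j u (j x)\<close>, which
  cannot vanish at \<open>x0\<close> because \<open>u x0\<close> is not \<open>0\<close>. In general it is only bounded by \<open>2 q\<close>, so half of it
  is taken at the end; the factor only matters for the bound, not for being nonzero at \<open>x0\<close>.\<close>

theorem Hahn_Banach_seminorm:
  assumes q: "seminorm smul q" and x0: "q x0 \<noteq> 0"
  obtains f :: "'x \<Rightarrow> 'k"
  where "Vector_Spaces.linear smul (*) f" "\<And>x. norm (f x) \<le> q x" "f x0 \<noteq> 0"
proof -
  obtain j :: 'k where j: "j = 0 \<or> j * j = - 1" and rep: "\<And>a :: 'k. \<exists>r s. a = of_real r + j * of_real s"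
    using real_or_complex_imaginary_unit by blast
  have "norm j * norm j \<le> 1"
    using j
  proof
    assume "j * j = - 1"
    then have "norm (j * j) = 1"
      by simp
    then show ?thesis
      by (simp add: norm_mult)
  qed simp
  have "sublinear q"
    using q by (simp add: sublinear_def seminorm_def)
  then obtain u where add: "\<And>x y. u (x + y) = u x + u y"
    and scale: "\<And>t x. u (rsmul t x) = t * u x" and le: "\<And>x. u x \<le> q x" and u0: "u x0 = q x0"
    using real_Hahn_Banach[of q x0] by blast
  have abs_le: "\<bar>u x\<bar> \<le> q x" for x
  proof -
    have "u (- x) = - u x"
      using scale[of "- 1" x] by simp
    then show ?thesis
      using le[of x] le[of "- x"] seminorm_minus[OF q, of x] by linarith
  qed
  define g where "g = (\<lambda>x. of_real (u x) - j * of_real (u (smul j x)))"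
  have g_add: "g (x + y) = g x + g y" for x y
    by (simp add: g_def add scale_right_distrib algebra_simps)
  have g_real: "g (rsmul t x) = of_real t * g x" for t x
  proof -
    have "u (smul j (rsmul t x)) = t * u (smul j x)"
      using scale[of t "smul j x"] by (simp add: mult.commute)
    then show ?thesis
      by (simp add: g_def scale algebra_simps)
  qed
  have g_j: "g (smul j x) = j * g x" for x
    using j
  proof
    assume "j = 0"
    then show ?thesis
      using scale[of 0 x] by (simp add: g_def)
  next
    assume jj: "j * j = - 1"
    have "u (- x) = - u x"
      using scale[of "- 1" x] by simp
    then have "g (smul j x) = of_real (u (smul j x)) + j * of_real (u x)"
      by (simp add: g_def jj)
    also have "\<dots> = j * of_real (u x) - (j * j) * of_real (u (smul j x))"
      by (simp add: jj)
    finally show ?thesis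
      by (simp add: g_def algebra_simps)
  qed
  have g_scale: "g (smul a x) = a * g x" for a x
  proof -
    obtain r s where "a = of_real r + j * of_real s"
      using rep by blast
    then show ?thesis
      using g_add[of "rsmul r x" "smul j (rsmul s x)"] g_j[of "rsmul s x"]
      by (simp add: scale_left_distrib g_real distrib_right mult.assoc)
  qed
  have g_le: "norm (g x) \<le> 2 * q x" for x
  proof -
    have "norm (g x) \<le> \<bar>u x\<bar> + norm j * \<bar>u (smul j x)\<bar>"
      unfolding g_def by (metis norm_mult norm_of_real norm_triangle_ineq4)
    also have "\<dots> \<le> q x + norm j * (norm j * q x)"
      using abs_le[of x] abs_le[of "smul j x"] seminorm_scale[OF q, of j x]
      by (intro add_mono mult_left_mono) auto
    also have "\<dots> \<le> q x + q x"
      using mult_right_mono[OF \<open>norm j * norm j \<le> 1\<close> seminorm_nonneg[OF q, of x]]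
      by (simp add: mult.assoc)
    finally show ?thesis
      by simp
  qed
  have "g x0 \<noteq> 0"
  proof
    assume "g x0 = 0"
    then have eq: "of_real (u x0) = j * of_real (u (smul j x0))"
      by (simp add: g_def)
    (* Squaring u x0 = j v gives (u x0)^2 = 0 or (u x0)^2 = - v^2, according to the value of j. *)
    define v where "v = u (smul j x0)"
    have "of_real (u x0 * u x0) = (j * j) * of_real (v * v)"
      using eq unfolding v_def by (simp add: algebra_simps)
    with j have "(of_real (u x0 * u x0) :: 'k) = of_real (- (v * v)) \<or> (of_real (u x0 * u x0) :: 'k) = of_real 0"
      by auto
    then have "u x0 * u x0 = - (v * v) \<or> u x0 * u x0 = 0"
      unfolding of_real_eq_iff .
    then have "u x0 = 0"
      using zero_le_square[of "u x0"] zero_le_square[of v]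
      by (metis le_minus_iff minus_zero order_antisym mult_eq_0_iff)
    then show False
      using u0 x0 by simp
  qed
  show ?thesis
  proof (rule that[of "\<lambda>x. g x / 2"])
    show "Vector_Spaces.linear smul (*) (\<lambda>x. g x / 2)"
      by (rule linear_functionalI) (simp_all add: g_add g_scale add_divide_distrib)
    show "norm (g x / 2) \<le> q x" for x
      using g_le[of x] by (simp add: norm_divide)
    show "g x0 / 2 \<noteq> 0"
      using \<open>g x0 \<noteq> 0\<close> by simp
  qed
qed

end

section \<open>Topologies generated by seminorms\<close>

lemma topspace_seminorm_topology [simp]: "topspace (seminorm_topology V P) = V"
  unfolding seminorm_topology_def topology_generated_by_topspace by auto

lemma openin_seminorm_ball:
  assumes "p \<in> P" "x \<in> V" "0 < e"
  shows "openin (seminorm_topology V P) {y \<in> V. p (y - x) < e}"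
  unfolding seminorm_topology_def by (rule topology_generated_by_Basis) (use assms in auto)

text \<open>Finite intersections of balls suffice: a ball with another centre contains a ball of the
  same seminorm around each of its points, by the triangle inequality. The space is only a set
  with a subtraction here, so that the lemma covers \<open>\<tau>\<^sub>F\<close> and the weak* topology alike.\<close>

lemma openin_seminorm_topologyD:
  assumes "openin (seminorm_topology V P) U" and x: "x \<in> U"
    and triangle: "\<And>p x y z. p \<in> P \<Longrightarrow> p (x - z) \<le> p (x - y) + p (y - z)"
  obtains F e where "finite F" "F \<subseteq> P" "0 < e" "{y \<in> V. \<forall>p\<in>F. p (y - x) < e} \<subseteq> U"
proof -
  have "generate_topology_on (insert V {{y \<in> V. p (y - x) < e} | p x e. p \<in> P \<and> x \<in> V \<and> 0 < e}) U"
    using assms(1) unfolding seminorm_topology_def openin_topology_generated_by_iff .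
  then have "\<forall>x\<in>U. \<exists>F e. finite F \<and> F \<subseteq> P \<and> 0 < e \<and> {y \<in> V. \<forall>p\<in>F. p (y - x) < e} \<subseteq> U"
  proof induction
    case Empty
    then show ?case by simp
  next
    case (Int A B)
    show ?case
    proof
      fix x assume x: "x \<in> A \<inter> B"
      obtain F e where F: "finite F" "F \<subseteq> P" "0 < e" "{y \<in> V. \<forall>p\<in>F. p (y - x) < e} \<subseteq> A"
        using Int.IH(1) x by (meson IntD1)
      obtain G d where G: "finite G" "G \<subseteq> P" "0 < d" "{y \<in> V. \<forall>p\<in>G. p (y - x) < d} \<subseteq> B"
        using Int.IH(2) x by (meson IntD2)
      have "{y \<in> V. \<forall>p\<in>F \<union> G. p (y - x) < min e d} \<subseteq> A \<inter> B"
        using F(4) G(4) by auto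
      moreover have "finite (F \<union> G)" "F \<union> G \<subseteq> P" "0 < min e d"
        using F G by auto
      ultimately show "\<exists>F e. finite F \<and> F \<subseteq> P \<and> 0 < e \<and> {y \<in> V. \<forall>p\<in>F. p (y - x) < e} \<subseteq> A \<inter> B"
        by blast
    qed
  next
    case (UN K)
    show ?case
    proof
      fix x assume "x \<in> \<Union>K"
      then obtain A where A: "A \<in> K" "x \<in> A"
        by blast
      then obtain F e where "finite F" "F \<subseteq> P" "0 < e" "{y \<in> V. \<forall>p\<in>F. p (y - x) < e} \<subseteq> A"
        using UN.IH by meson
      then show "\<exists>F e. finite F \<and> F \<subseteq> P \<and> 0 < e \<and> {y \<in> V. \<forall>p\<in>F. p (y - x) < e} \<subseteq> \<Union>K"
        using A by (meson Union_upper subset_trans)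
    qed
  next
    case (Basis S)
    show ?case
    proof
      fix x assume x: "x \<in> S"
      from Basis consider "S = V"
        | p z e where "S = {y \<in> V. p (y - z) < e}" "p \<in> P" "z \<in> V" "0 < e"
        by blast
      then show "\<exists>F e. finite F \<and> F \<subseteq> P \<and> 0 < e \<and> {y \<in> V. \<forall>p\<in>F. p (y - x) < e} \<subseteq> S"
      proof cases
        case 1
        then show ?thesis
          by (intro exI[of _ "{}"] exI[of _ "1::real"]) auto
      next
        case 2
        (* The part of the radius that is left after moving the centre from z to x. *)
        have "{y \<in> V. \<forall>p'\<in>{p}. p' (y - x) < e - p (x - z)} \<subseteq> S"
          using triangle[OF 2(2), of _ z x] 2(1) by (fastforce intro: le_less_trans)
        moreover have "0 < e - p (x - z)"
          using 2(1) x by simp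
        ultimately show ?thesis
          using 2(2) by (intro exI[of _ "{p}"] exI[of _ "e - p (x - z)"]) auto
      qed
    qed
  qed
  then show ?thesis
    using x that by meson
qed

lemma separable_space_iff:
  "separable_space X \<longleftrightarrow>
     (\<exists>D. countable D \<and> D \<subseteq> topspace X \<and> (\<forall>U x. openin X U \<and> x \<in> U \<longrightarrow> (\<exists>d\<in>D. d \<in> U)))"
proof -
  have "X closure_of D = topspace X \<longleftrightarrow> (\<forall>U x. openin X U \<and> x \<in> U \<longrightarrow> (\<exists>d\<in>D. d \<in> U))" for D
    unfolding dense_intersects_open by (metis disjoint_iff ex_in_conv)
  then show ?thesis
    unfolding separable_space_def by simp
qed

section \<open>Extended norms and the finest locally convex topology\<close>

sublocale extended_normed_space \<subseteq> real_or_complex_space smul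
  by unfold_locales

context extended_normed_space
begin

lemma enorm_dist_less_iff:
  assumes "0 < r" "r \<le> 1"
  shows "enorm_dist enorm x y < r \<longleftrightarrow> enorm (y - x) < ennreal r"
proof -
  have "0 \<le> enorm_dist enorm x y"
    by (simp add: enorm_dist_def)
  then have "enorm_dist enorm x y < r \<longleftrightarrow> ennreal (enorm_dist enorm x y) < ennreal r"
    by (simp add: ennreal_less_iff)
  also have "\<dots> \<longleftrightarrow> enorm (x - y) < ennreal r"
    using assms ennreal_leI[of r 1] unfolding enorm_dist_ennreal by (simp add: min_less_iff_disj not_less)
  also have "enorm (x - y) = enorm (y - x)"
    using enorm_minus[of "x - y"] by simp
  finally show ?thesis .
qed

lemma openin_enorm_topology:
  "openin (enorm_topology V enorm) U \<longleftrightarrow>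
     U \<subseteq> V \<and> (\<forall>x\<in>U. \<exists>r>0. \<forall>y\<in>V. enorm (y - x) < ennreal r \<longrightarrow> y \<in> U)"
proof -
  interpret Metric_space V "enorm_dist enorm"
    by (rule Metric_space_enorm_dist)
  have "(\<exists>r>0. mball x r \<subseteq> U) \<longleftrightarrow> (\<exists>r>0. \<forall>y\<in>V. enorm (y - x) < ennreal r \<longrightarrow> y \<in> U)" if x: "x \<in> V" for x
  proof
    assume "\<exists>r>0. mball x r \<subseteq> U"
    then obtain r where r: "0 < r" "mball x r \<subseteq> U"
      by blast
    have "y \<in> U" if y: "y \<in> V" "enorm (y - x) < ennreal (min r 1)" for y
    proof -
      have "enorm_dist enorm x y < min r 1"
        using y r(1) by (subst enorm_dist_less_iff) auto
      then show ?thesis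
        using r(2) x y(1) by auto
    qed
    then show "\<exists>r>0. \<forall>y\<in>V. enorm (y - x) < ennreal r \<longrightarrow> y \<in> U"
      using r(1) by (intro exI[of _ "min r 1"]) auto
  next
    assume "\<exists>r>0. \<forall>y\<in>V. enorm (y - x) < ennreal r \<longrightarrow> y \<in> U"
    then obtain r where r: "0 < r" "\<And>y. y \<in> V \<Longrightarrow> enorm (y - x) < ennreal r \<Longrightarrow> y \<in> U"
      by blast
    have "y \<in> U" if y: "y \<in> mball x (min r 1)" for y
    proof -
      have "enorm (y - x) < ennreal (min r 1)"
        using y r(1) by (subst enorm_dist_less_iff[symmetric]) auto
      also have "\<dots> \<le> ennreal r"
        by (rule ennreal_leI) simp
      finally show ?thesis
        using r(2) y by auto
    qed
    then show "\<exists>r>0. mball x r \<subseteq> U"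
      using r(1) by (intro exI[of _ "min r 1"]) auto
  qed
  then show ?thesis
    unfolding enorm_topology_def openin_mtopology by blast
qed

text \<open>The factor \<open>c\<close> must be positive: \<open>0 * \<infinity> = 0\<close> would otherwise turn the bound into a condition on the
  vectors of infinite norm, on which a dominated seminorm is meant to be arbitrary. These are exactly
  the seminorms that are continuous for the extended norm.\<close>

definition dominated_seminorm :: "('x \<Rightarrow> real) \<Rightarrow> bool" where
  "dominated_seminorm p \<longleftrightarrow> seminorm smul p \<and> (\<exists>c>0. \<forall>x. ennreal (p x) \<le> ennreal c * enorm x)"

lemma dominated_imp_seminorm: "dominated_seminorm p \<Longrightarrow> seminorm smul p"
  by (simp add: dominated_seminorm_def)

lemma dominated_seminorm_zero: "dominated_seminorm (\<lambda>x. 0)"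
  unfolding dominated_seminorm_def seminorm_def by (auto intro: exI[of _ "1::real"])

lemma dominated_seminorm_add:
  assumes "dominated_seminorm p" "dominated_seminorm q"
  shows "dominated_seminorm (\<lambda>x. p x + q x)"
proof -
  obtain c d where c: "0 < c" "\<And>x. ennreal (p x) \<le> ennreal c * enorm x"
    and d: "0 < d" "\<And>x. ennreal (q x) \<le> ennreal d * enorm x"
    using assms unfolding dominated_seminorm_def by blast
  note sp = dominated_imp_seminorm[OF assms(1)] and sq = dominated_imp_seminorm[OF assms(2)]
  have "seminorm smul (\<lambda>x. p x + q x)"
    unfolding seminorm_def
  proof (intro conjI allI)
    show "p (x + y) + q (x + y) \<le> p x + q x + (p y + q y)" for x y
      using seminorm_add[OF sp, of x y] seminorm_add[OF sq, of x y] by linarith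
  qed (simp_all add: seminorm_nonneg sp sq seminorm_scale algebra_simps)
  moreover have "ennreal (p x + q x) \<le> ennreal (c + d) * enorm x" for x
    using add_mono[OF c(2) d(2), of x x] c(1) d(1)
    by (simp add: seminorm_nonneg sp sq distrib_right)
  ultimately show ?thesis
    using c(1) d(1) unfolding dominated_seminorm_def by (intro conjI exI[of _ "c + d"]) auto
qed

lemma dominated_seminorm_sum:
  assumes "finite F" "\<And>p. p \<in> F \<Longrightarrow> dominated_seminorm p"
  shows "dominated_seminorm (\<lambda>x. \<Sum>p\<in>F. p x)"
  using assms by induction (simp_all add: dominated_seminorm_zero dominated_seminorm_add)

lemma openin_dominated_ball:
  assumes p: "dominated_seminorm p"
  shows "openin (enorm_topology UNIV enorm) {y. p (y - x) < e}"
proof -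
  obtain c where c: "0 < c" "\<And>x. ennreal (p x) \<le> ennreal c * enorm x"
    using p unfolding dominated_seminorm_def by blast
  have "\<exists>r>0. \<forall>z. enorm (z - y) < ennreal r \<longrightarrow> p (z - x) < e" if y: "p (y - x) < e" for y
  proof (intro exI[of _ "(e - p (y - x)) / c"] conjI allI impI)
    show "0 < (e - p (y - x)) / c"
      using y c(1) by simp
    fix z assume "enorm (z - y) < ennreal ((e - p (y - x)) / c)"
    then have "ennreal c * enorm (z - y) < ennreal c * ennreal ((e - p (y - x)) / c)"
      using c(1) by (intro ennreal_mult_strict_left_mono) auto
    also have "\<dots> = ennreal (e - p (y - x))"
      using c(1) y by (simp flip: ennreal_mult)
    finally have "ennreal (p (z - y)) < ennreal (e - p (y - x))"
      using c(2)[of "z - y"] by (rule le_less_trans[rotated])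
    then have "p (z - y) < e - p (y - x)"
      using y by (simp add: ennreal_less_iff seminorm_nonneg[OF dominated_imp_seminorm[OF p]])
    then show "p (z - x) < e"
      using seminorm_triangle[OF dominated_imp_seminorm[OF p], of z x y] by linarith
  qed
  then show ?thesis
    unfolding openin_enorm_topology by simp
qed

text \<open>Vectors of finite norm can be scaled into the open set, which gives the bound on them. On vectors of
  infinite norm the bound is \<open>\<infinity>\<close>.\<close>

lemma dominated_seminormI:
  assumes p: "seminorm smul p" and "openin (enorm_topology UNIV enorm) {y. p y < 1}"
  shows "dominated_seminorm p"
proof -
  have "0 \<in> {y. p y < 1}"
    by (simp add: seminorm_zero[OF p])
  then have "\<exists>r>0. \<forall>y\<in>UNIV. enorm (y - 0) < ennreal r \<longrightarrow> y \<in> {y. p y < 1}"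
    using assms(2) unfolding openin_enorm_topology by blast
  then obtain r where r: "0 < r" "\<And>y. enorm y < ennreal r \<Longrightarrow> p y < 1"
    by auto
  have "ennreal (p x) \<le> ennreal (2 / r) * enorm x" for x
  proof (cases "enorm x")
    case (real t)
    show ?thesis
    proof (cases "t = 0")
      case True
      then show ?thesis
        using real enorm_eq_0_iff[of x] by (simp add: seminorm_zero[OF p])
    next
      case False
      then have t: "0 < t"
        using real by simp
      (* Scaling to norm r / 2 stays strictly inside the ball of radius r. *)
      have n: "norm (of_real (r / (2 * t)) :: 'k) = r / (2 * t)"
        unfolding norm_of_real using t r(1) by simp
      have "enorm (rsmul (r / (2 * t)) x) = ennreal (r / 2)"
        unfolding enorm_scale real(2) n using t r(1) by (simp flip: ennreal_mult)
      also have "\<dots> < ennreal r"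
        using r(1) by (simp add: ennreal_less_iff)
      finally have "p (rsmul (r / (2 * t)) x) < 1"
        by (rule r(2))
      then have "p x < 2 / r * t"
        using t r(1) unfolding seminorm_scale[OF p] n by (simp add: field_simps)
      then have "ennreal (p x) \<le> ennreal (2 / r * t)"
        by (intro ennreal_leI) simp
      moreover have "ennreal (2 / r * t) = ennreal (2 / r) * ennreal t"
        using t r(1) by (intro ennreal_mult) auto
      ultimately show ?thesis
        by (simp only: real(2))
    qed
  next
    case top
    then show ?thesis
      using r(1) by (simp add: ennreal_mult_top)
  qed
  then show ?thesis
    using p r(1) unfolding dominated_seminorm_def by (intro conjI exI[of _ "2 / r"]) auto
qed

text \<open>The characterization through which \<open>\<tau>\<^sub>F\<close> is used from here on. A dominated seminorm alone generates
  a locally convex topology coarser than that of the extended norm, hence coarser than \<open>\<tau>\<^sub>F\<close>; so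
  its balls are \<open>\<tau>\<^sub>F\<close>-open. Conversely any seminorm in a generating family of \<open>\<tau>\<^sub>F\<close> is dominated, and one
  ball suffices because finite sums of dominated seminorms are dominated.\<close>

lemma openin_flc_topology:
  "openin (flc_topology smul enorm) U \<longleftrightarrow>
     (\<forall>x\<in>U. \<exists>p e. dominated_seminorm p \<and> 0 < e \<and> {y. p (y - x) < e} \<subseteq> U)"
proof -
  let ?T = "flc_topology smul enorm" and ?N = "enorm_topology UNIV enorm"
  have flc: "is_flc_topology smul enorm ?T"
    by (rule is_flc_topology_flc_topology)
  have ball: "openin ?T {y. p (y - x) < e}" if p: "dominated_seminorm p" and e: "0 < e" for p x e
  proof -
    let ?T' = "seminorm_topology UNIV {p}"
    note sp = dominated_imp_seminorm[OF p]
    have "openin ?N V" if V: "openin ?T' V" for V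
    proof (subst openin_subopen, intro ballI)
      fix x assume "x \<in> V"
      with V obtain F e where F: "F \<subseteq> {p}" "0 < e" "{y \<in> UNIV. \<forall>p\<in>F. p (y - x) < e} \<subseteq> V"
        by (rule openin_seminorm_topologyD) (use seminorm_triangle[OF sp] in auto)
      have "x \<in> {y. p (y - x) < e}"
        using F(2) by (simp add: seminorm_zero[OF sp])
      moreover have "{y. p (y - x) < e} \<subseteq> V"
        using F(1,3) by auto
      ultimately show "\<exists>T. openin ?N T \<and> x \<in> T \<and> T \<subseteq> V"
        using openin_dominated_ball[OF p] by blast
    qed
    then have "coarser_topology ?T' ?N"
      by (simp add: coarser_topology_def topspace_enorm_topology)
    moreover have "locally_convex_topology smul ?T'"
      unfolding locally_convex_topology_def using sp by (intro exI[of _ "{p}"]) auto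
    ultimately have "coarser_topology ?T' ?T"
      using flc unfolding is_flc_topology_def by blast
    moreover have "openin ?T' {y. p (y - x) < e}"
      using openin_seminorm_ball[of p "{p}" x UNIV e] e by simp
    ultimately show ?thesis
      unfolding coarser_topology_def by blast
  qed
  obtain Q where Q: "\<And>p. p \<in> Q \<Longrightarrow> seminorm smul p" "?T = seminorm_topology UNIV Q"
    and coarser: "coarser_topology ?T ?N"
    using flc unfolding is_flc_topology_def locally_convex_topology_def by blast
  have dom: "dominated_seminorm p" if p: "p \<in> Q" for p
  proof (rule dominated_seminormI[OF Q(1)[OF p]])
    have "openin ?T {y. p (y - 0) < 1}"
      using openin_seminorm_ball[of p Q 0 UNIV 1] p Q(2) by simp
    then show "openin ?N {y. p y < 1}"
      using coarser unfolding coarser_topology_def by simp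
  qed
  show ?thesis
  proof
    assume U: "openin ?T U"
    show "\<forall>x\<in>U. \<exists>p e. dominated_seminorm p \<and> 0 < e \<and> {y. p (y - x) < e} \<subseteq> U"
    proof
      fix x assume "x \<in> U"
      with U[unfolded Q(2)] obtain F e
        where F: "finite F" "F \<subseteq> Q" "0 < e" "{y \<in> UNIV. \<forall>p\<in>F. p (y - x) < e} \<subseteq> U"
        by (rule openin_seminorm_topologyD) (rule seminorm_triangle[OF Q(1)])
      let ?p = "\<lambda>x. \<Sum>p\<in>F. p x"
      have "p (y - x) \<le> ?p (y - x)" if "p \<in> F" for p y
        using that F(1) seminorm_nonneg[OF Q(1)[OF subsetD[OF F(2)]]] by (intro member_le_sum) auto
      then have "{y. ?p (y - x) < e} \<subseteq> U"
        using F(4) by (fastforce intro: le_less_trans)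
      moreover have "dominated_seminorm ?p"
        using F(1,2) dom by (intro dominated_seminorm_sum) auto
      ultimately show "\<exists>p e. dominated_seminorm p \<and> 0 < e \<and> {y. p (y - x) < e} \<subseteq> U"
        using F(3) by blast
    qed
  next
    assume U: "\<forall>x\<in>U. \<exists>p e. dominated_seminorm p \<and> 0 < e \<and> {y. p (y - x) < e} \<subseteq> U"
    show "openin ?T U"
    proof (subst openin_subopen, intro ballI)
      fix x assume "x \<in> U"
      then obtain p e where p: "dominated_seminorm p" "0 < e" "{y. p (y - x) < e} \<subseteq> U"
        using U by blast
      moreover have "x \<in> {y. p (y - x) < e}"
        using p(2) by (simp add: seminorm_zero[OF dominated_imp_seminorm[OF p(1)]])
      ultimately show "\<exists>T. openin ?T T \<and> x \<in> T \<and> T \<subseteq> U"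
        using ball[OF p(1,2)] by blast
    qed
  qed
qed

lemma topspace_flc_topology: "topspace (flc_topology smul enorm) = UNIV"
proof -
  have "openin (flc_topology smul enorm) UNIV"
    unfolding openin_flc_topology using dominated_seminorm_zero by (meson subset_UNIV zero_less_one)
  then show ?thesis
    using openin_subset by blast
qed

lemma separable_flc_topology_iff:
  "separable_space (subtopology (flc_topology smul enorm) V) \<longleftrightarrow>
     (\<exists>D. countable D \<and> D \<subseteq> V \<and>
        (\<forall>x\<in>V. \<forall>p e. dominated_seminorm p \<longrightarrow> 0 < e \<longrightarrow> (\<exists>d\<in>D. p (d - x) < e)))"
proof -
  have eq: "(\<forall>U x. openin (subtopology (flc_topology smul enorm) V) U \<and> x \<in> U \<longrightarrow> (\<exists>d\<in>D. d \<in> U)) \<longleftrightarrow>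
    (\<forall>x\<in>V. \<forall>p e. dominated_seminorm p \<longrightarrow> 0 < e \<longrightarrow> (\<exists>d\<in>D. p (d - x) < e))"
    (is "?L \<longleftrightarrow> ?R") if D: "D \<subseteq> V" for D
  proof
    assume L: ?L
    show ?R
    proof (intro ballI allI impI)
      fix x p and e :: real assume x: "x \<in> V" and p: "dominated_seminorm p" and e: "0 < e"
      note sp = dominated_imp_seminorm[OF p]
      have "openin (flc_topology smul enorm) {y. p (y - x) < e}"
        unfolding openin_flc_topology
      proof
        fix y assume "y \<in> {y. p (y - x) < e}"
        moreover have "{z. p (z - y) < e - p (y - x)} \<subseteq> {y. p (y - x) < e}"
          using seminorm_triangle[OF sp, of _ x y] by (fastforce intro: le_less_trans)
        ultimately show "\<exists>q d. dominated_seminorm q \<and> 0 < d \<and> {z. q (z - y) < d} \<subseteq> {y. p (y - x) < e}"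
          using p by (intro exI[of _ p] exI[of _ "e - p (y - x)"]) auto
      qed
      then have "openin (subtopology (flc_topology smul enorm) V) ({y. p (y - x) < e} \<inter> V)"
        unfolding openin_subtopology by blast
      moreover have "x \<in> {y. p (y - x) < e} \<inter> V"
        using x e by (simp add: seminorm_zero[OF sp])
      ultimately show "\<exists>d\<in>D. p (d - x) < e"
        using L by blast
    qed
  next
    assume R: ?R
    show ?L
    proof (intro allI impI, elim conjE)
      fix U x assume "openin (subtopology (flc_topology smul enorm) V) U" and x: "x \<in> U"
      then obtain T where T: "openin (flc_topology smul enorm) T" "U = T \<inter> V"
        unfolding openin_subtopology by blast
      with x obtain p e where "dominated_seminorm p" "0 < e" "{y. p (y - x) < e} \<subseteq> T"
        unfolding openin_flc_topology by blast
      moreover from this obtain d where "d \<in> D" "p (d - x) < e"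
        using R x T(2) by blast
      ultimately show "\<exists>d\<in>D. d \<in> U"
        using D T(2) by blast
    qed
  qed
  show ?thesis
    unfolding separable_space_iff topspace_subtopology topspace_flc_topology Int_UNIV_left
    by (intro ex_cong1 conj_cong refl eq)
qed

lemma separable_enorm_topology_iff:
  "separable_space (enorm_topology V enorm) \<longleftrightarrow>
     (\<exists>D. countable D \<and> D \<subseteq> V \<and> (\<forall>x\<in>V. \<forall>r>0. \<exists>d\<in>D. enorm (d - x) < ennreal r))"
proof -
  have eq: "(\<forall>U x. openin (enorm_topology V enorm) U \<and> x \<in> U \<longrightarrow> (\<exists>d\<in>D. d \<in> U)) \<longleftrightarrow>
    (\<forall>x\<in>V. \<forall>r>0. \<exists>d\<in>D. enorm (d - x) < ennreal r)" (is "?L \<longleftrightarrow> ?R") if D: "D \<subseteq> V" for D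
  proof
    assume L: ?L
    show ?R
    proof (intro ballI allI impI)
      fix x and r :: real assume x: "x \<in> V" and r: "0 < r"
      have "openin (enorm_topology V enorm) {y \<in> V. enorm (y - x) < ennreal r}"
        unfolding openin_enorm_topology
      proof (intro conjI ballI)
        fix y assume y: "y \<in> {y \<in> V. enorm (y - x) < ennreal r}"
        obtain t where t: "0 \<le> t" "enorm (y - x) = ennreal t"
          using y by (cases "enorm (y - x)") auto
        have "z \<in> {y \<in> V. enorm (y - x) < ennreal r}" if z: "z \<in> V" "enorm (z - y) < ennreal (r - t)" for z
        proof -
          have "enorm (z - x) \<le> enorm (z - y) + enorm (y - x)"
            using enorm_triangle[of "z - y" "y - x"] by simp
          also have "\<dots> < ennreal (r - t) + ennreal t"
            using z(2) t by (simp add: ennreal_add_left_cancel_less add.commute)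
          also have "\<dots> = ennreal r"
            using t y by (simp add: ennreal_less_iff flip: ennreal_plus)
          finally show ?thesis
            using z(1) by simp
        qed
        moreover have "0 < r - t"
          using t y by (simp add: ennreal_less_iff)
        ultimately show "\<exists>s>0. \<forall>z\<in>V. enorm (z - y) < ennreal s \<longrightarrow> z \<in> {y \<in> V. enorm (y - x) < ennreal r}"
          by blast
      qed auto
      moreover have "x \<in> {y \<in> V. enorm (y - x) < ennreal r}"
        using x r by (simp add: enorm_zero)
      ultimately show "\<exists>d\<in>D. enorm (d - x) < ennreal r"
        using L by blast
    qed
  next
    assume R: ?R
    show ?L
    proof (intro allI impI, elim conjE)
      fix U x assume "openin (enorm_topology V enorm) U" and x: "x \<in> U"
      then obtain r where "0 < r" "x \<in> V" "\<And>y. y \<in> V \<Longrightarrow> enorm (y - x) < ennreal r \<Longrightarrow> y \<in> U"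
        unfolding openin_enorm_topology by blast
      then show "\<exists>d\<in>D. d \<in> U"
        using R D by blast
    qed
  qed
  show ?thesis
    unfolding separable_space_iff topspace_enorm_topology
    by (intro ex_cong1 conj_cong refl eq)
qed

end

section \<open>Seminorms, spans and functionals\<close>

context real_or_complex_space
begin

lemma quotient_seminorm:
  assumes p: "seminorm smul p" and Y: "subspace Y"
  shows "seminorm smul (\<lambda>x. INF y\<in>Y. p (x - y))"
    and "z \<in> Y \<Longrightarrow> (INF y\<in>Y. p (x - y)) \<le> p (x - z)"
proof -
  define q where "q = (\<lambda>x. INF y\<in>Y. p (x - y))"
  have ne: "Y \<noteq> {}"
    using subspace_0[OF Y] by auto
  have "bdd_below ((\<lambda>y. p (x - y)) ` Y)" for x
    using seminorm_nonneg[OF p] by (intro bdd_belowI2)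
  then have lower: "q x \<le> p (x - y)" if "y \<in> Y" for x y
    unfolding q_def using that by (rule cINF_lower)
  have greatest: "b \<le> q x" if "\<And>y. y \<in> Y \<Longrightarrow> b \<le> p (x - y)" for b x
    unfolding q_def using ne that by (rule cINF_greatest)
  have nonneg: "0 \<le> q x" for x
    by (rule greatest) (rule seminorm_nonneg[OF p])
  have scale_le: "q (smul a x) \<le> norm a * q x" if a: "a \<noteq> 0" for a x
  proof -
    have "q (smul a x) / norm a \<le> q x"
    proof (rule greatest)
      fix y assume "y \<in> Y"
      then have "q (smul a x) \<le> p (smul a x - smul a y)"
        by (intro lower subspace_scale Y)
      also have "\<dots> = norm a * p (x - y)"
        by (simp add: seminorm_scale[OF p] flip: scale_right_diff_distrib)
      finally show "q (smul a x) / norm a \<le> p (x - y)"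
        using a by (simp add: field_simps)
    qed
    then show ?thesis
      using a by (simp add: field_simps)
  qed
  have "seminorm smul q"
    unfolding seminorm_def
  proof (intro conjI allI)
    show "0 \<le> q x" for x
      by (rule nonneg)
    have q0: "q 0 = 0"
      using lower[OF subspace_0[OF Y], of 0] nonneg[of 0] by (simp add: seminorm_zero[OF p])
    show "q (smul a x) = norm a * q x" for a x
    proof (cases "a = 0")
      case True
      then show ?thesis
        by (simp add: q0)
    next
      case False
      then have "norm a * q x \<le> q (smul a x)"
        using mult_left_mono[OF scale_le[of "inverse a" "smul a x"], of "norm a"]
        by (simp add: norm_inverse flip: mult.assoc)
      then show ?thesis
        using scale_le[OF False, of x] by simp
    qed
    show "q (x + y) \<le> q x + q y" for x y
    proof -
      have *: "q (x + y) \<le> p (x - v) + p (y - w)" if "v \<in> Y" "w \<in> Y" for v w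
        using lower[OF subspace_add[OF Y that], of "x + y"] seminorm_add[OF p, of "x - v" "y - w"]
        by (simp add: algebra_simps)
      have "q (x + y) - p (y - w) \<le> q x" if "w \<in> Y" for w
        by (rule greatest) (use *[OF _ that] in \<open>simp add: algebra_simps\<close>)
      then have "q (x + y) - q x \<le> q y"
        by (intro greatest) (simp add: algebra_simps)
      then show ?thesis
        by simp
    qed
  qed
  then show "seminorm smul (\<lambda>x. INF y\<in>Y. p (x - y))"
    by (simp add: q_def)
  show "z \<in> Y \<Longrightarrow> (INF y\<in>Y. p (x - y)) \<le> p (x - z)"
    using lower[of z x] by (simp add: q_def)
qed

text \<open>Finite linear combinations with coefficients in a countable dense set of scalars. One
  countable set works for every seminorm, continuous or not, because only finitely many coefficients
  are perturbed at a time.\<close>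

lemma countable_dense_in_span:
  assumes D: "countable D"
  obtains C where "countable C"
    "\<And>x p e. x \<in> span D \<Longrightarrow> seminorm smul p \<Longrightarrow> 0 < e \<Longrightarrow> \<exists>c\<in>C. p (c - x) < e"
proof -
  obtain Q :: "'k set" where Q: "countable Q" "\<And>a e. 0 < e \<Longrightarrow> \<exists>q\<in>Q. norm (a - q) < e"
    using countable_dense_scalars by blast
  define C where "C = (\<lambda>l. \<Sum>(a, d)\<leftarrow>l. smul a d) ` lists (Q \<times> D)"
  have "countable C"
    unfolding C_def using Q(1) D by (intro countable_image countable_lists countable_SIGMA)
  moreover have "\<exists>c\<in>C. p (c - x) < e" if x: "x \<in> span D" and p: "seminorm smul p" and "0 < e" for x p e
    using x \<open>0 < e\<close>
  proof (induction x arbitrary: e rule: span_induct_alt)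
    case base
    have "0 \<in> C"
      unfolding C_def by (intro image_eqI[of _ _ "[]"]) auto
    then show ?case
      using base seminorm_zero[OF p] by force
  next
    case (step a d y)
    obtain l where l: "l \<in> lists (Q \<times> D)" "p ((\<Sum>(a, d)\<leftarrow>l. smul a d) - y) < e / 2"
      using step.IH[of "e / 2"] step.prems unfolding C_def by auto
    (* p d may be 0, so p d + 1 is used as the denominator. *)
    have pd: "0 < p d + 1"
      using seminorm_nonneg[OF p, of d] by simp
    then obtain q where q: "q \<in> Q" "norm (a - q) < e / (2 * (p d + 1))"
      using Q(2)[of "e / (2 * (p d + 1))" a] step.prems by auto
    let ?c = "smul q d + (\<Sum>(a, d)\<leftarrow>l. smul a d)"
    have "norm (q - a) * p d \<le> norm (a - q) * (p d + 1)"
      using pd by (simp add: norm_minus_commute mult_left_mono)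
    also have "\<dots> < e / 2"
      using q(2) pd by (simp add: field_simps)
    finally have "p (smul (q - a) d) < e / 2"
      by (simp add: seminorm_scale[OF p])
    moreover have eq: "?c - (smul a d + y) = smul (q - a) d + ((\<Sum>(a, d)\<leftarrow>l. smul a d) - y)"
      by (simp add: scale_left_diff_distrib)
    ultimately have "p (?c - (smul a d + y)) < e"
      unfolding eq using l(2) seminorm_add[OF p, of "smul (q - a) d" "(\<Sum>(a, d)\<leftarrow>l. smul a d) - y"] by linarith
    moreover have "?c \<in> C"
      unfolding C_def using l(1) q(1) step.hyps by (intro image_eqI[of _ _ "(q, d) # l"]) auto
    ultimately show ?case
      by blast
  qed
  ultimately show ?thesis
    by (rule that)
qed

lemma seminorm_norm_functional:
  "Vector_Spaces.linear smul (*) f \<Longrightarrow> seminorm smul (\<lambda>x. norm (f x :: 'k))"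
  unfolding seminorm_def by (auto simp: linear_functionalD norm_mult norm_triangle_ineq)

text \<open>Purely algebraic: extend an independent set spanning \<open>S\<close> by \<open>x\<close> and prescribe the values.\<close>

lemma separating_functional:
  assumes x: "x \<notin> span S"
  obtains f :: "'x \<Rightarrow> 'k" where "Vector_Spaces.linear smul (*) f" "\<And>s. s \<in> S \<Longrightarrow> f s = 0" "f x = 1"
proof -
  interpret vector_space_pair smul "(*) :: 'k \<Rightarrow> 'k \<Rightarrow> 'k"
    using vector_space_scalars vector_space_axioms by (simp add: vector_space_pair_def)
  obtain B where B: "B \<subseteq> S" "independent B" "S \<subseteq> span B"
    by (rule maximal_independent_subset)
  have xB: "x \<notin> span B"
    using x span_mono[OF B(1)] by blast
  then have "independent (insert x B)"
    using B(2) by (simp add: independent_insert)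
  then obtain f where f: "Vector_Spaces.linear smul (*) f"
    "\<forall>y\<in>insert x B. f y = (if y = x then 1 else 0)"
    using linear_independent_extend[of "insert x B" "\<lambda>y. if y = x then 1 else 0"] by blast
  have "f y = 0" if "y \<in> B" for y
    using f(2) that xB span_base[OF that] by auto
  then have "f s = 0" if "s \<in> S" for s
    using linear_eq_0_on_span[OF f(1)] B(3) that by blast
  with f show ?thesis
    by (intro that[of f]) auto
qed

lemma direct_sum_projection:
  assumes "direct_sum_decomposition smul V W"
  obtains \<pi> where "\<And>x. \<pi> x \<in> V" "\<And>x. x - \<pi> x \<in> W"
    "\<And>x y. \<pi> (x + y) = \<pi> x + \<pi> y" "\<And>a x. \<pi> (smul a x) = smul a (\<pi> x)"
    "\<And>v. v \<in> V \<Longrightarrow> \<pi> v = v" "\<And>w. w \<in> W \<Longrightarrow> \<pi> w = 0"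
proof -
  have V: "subspace V" and W: "subspace W" and VW: "V \<inter> W = {0}"
    and sum: "{v + w | v w. v \<in> V \<and> w \<in> W} = UNIV"
    using assms by (auto simp: direct_sum_decomposition_def)
  have unique: "v = v'" if "v \<in> V" "v' \<in> V" "x - v \<in> W" "x - v' \<in> W" for x v v'
  proof -
    have "v - v' \<in> V"
      using that(1,2) by (rule subspace_diff[OF V])
    moreover have "(x - v') - (x - v) \<in> W"
      using that(4,3) by (rule subspace_diff[OF W])
    ultimately have "v - v' \<in> V \<inter> W"
      by simp
    then show ?thesis
      using VW by simp
  qed
  have "\<exists>v. v \<in> V \<and> x - v \<in> W" for x
  proof -
    have "x \<in> {v + w | v w. v \<in> V \<and> w \<in> W}"
      by (simp add: sum)
    then obtain v w where "x = v + w" "v \<in> V" "w \<in> W"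
      by blast
    then show ?thesis
      by (intro exI[of _ v]) simp
  qed
  then obtain \<pi> where \<pi>: "\<And>x. \<pi> x \<in> V" "\<And>x. x - \<pi> x \<in> W"
    by metis
  show ?thesis
  proof (rule that[OF \<pi>])
    show "\<pi> (x + y) = \<pi> x + \<pi> y" for x y
    proof (rule unique[of _ _ "x + y"])
      show "x + y - (\<pi> x + \<pi> y) \<in> W"
        using subspace_add[OF W \<pi>(2)[of x] \<pi>(2)[of y]] by (simp add: algebra_simps)
    qed (intro \<pi> subspace_add V)+
    show "\<pi> (smul a x) = smul a (\<pi> x)" for a x
    proof (rule unique[of _ _ "smul a x"])
      show "smul a x - smul a (\<pi> x) \<in> W"
        using subspace_scale[OF W \<pi>(2)[of x], of a] by (simp add: scale_right_diff_distrib)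
    qed (intro \<pi> subspace_scale V)+
    show "\<pi> v = v" if "v \<in> V" for v
      by (rule unique[of _ _ v]) (use that \<pi> subspace_0[OF W] in auto)
    show "\<pi> w = 0" if "w \<in> W" for w
      by (rule unique[of _ _ w]) (use that \<pi> subspace_0[OF V] in auto)
  qed
qed

end

section \<open>The dual unit ball\<close>

context extended_normed_space
begin

abbreviation dual_ball :: "('x \<Rightarrow> 'k) set" where
  "dual_ball \<equiv> dual_unit_ball smul enorm"

abbreviation weak_star_ball :: "('x \<Rightarrow> 'k) topology" where
  "weak_star_ball \<equiv> subtopology (weak_star_topology smul enorm) dual_ball"

text \<open>Continuity is automatic: the bound by the extended norm makes \<open>f\<close> a contraction on each translate of
  the subspace of finite vectors, and each such translate is open. The bound says nothing about \<open>f\<close> on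
  a complement of that subspace.\<close>

lemma mem_dual_ball_iff:
  "f \<in> dual_ball \<longleftrightarrow> Vector_Spaces.linear smul (*) f \<and> (\<forall>x. ennreal (norm (f x)) \<le> enorm x)"
proof
  assume "f \<in> dual_ball"
  then have f: "Vector_Spaces.linear smul (*) f" and "op_norm enorm f \<le> 1"
    by (auto simp: dual_unit_ball_def dual_space_def)
  then have le1: "ennreal (norm (f x)) \<le> 1" if "enorm x \<le> 1" for x
  proof -
    have "ennreal (norm (f x)) \<le> op_norm enorm f"
      unfolding op_norm_def by (rule SUP_upper) (use that in simp)
    with \<open>op_norm enorm f \<le> 1\<close> show ?thesis
      by (rule order_trans[rotated])
  qed
  have "ennreal (norm (f x)) \<le> enorm x" for x
  proof (cases "enorm x")
    case (real t)
    show ?thesis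
    proof (cases "t = 0")
      case True
      then show ?thesis
        using real enorm_eq_0_iff[of x] by (simp add: linear_functionalD(3)[OF f])
    next
      case False
      then have t: "0 < t"
        using real by simp
      have n: "norm (of_real (1 / t) :: 'k) = 1 / t"
        unfolding norm_of_real using t by simp
      have "enorm (rsmul (1 / t) x) = 1"
        unfolding enorm_scale real(2) n using t by (simp flip: ennreal_mult)
      then have "ennreal (norm (f (rsmul (1 / t) x))) \<le> ennreal 1"
        using le1 by simp
      then have "1 / t * norm (f x) \<le> 1"
        unfolding linear_functionalD(2)[OF f] norm_mult n by (subst (asm) ennreal_le_iff) auto
      then show ?thesis
        using t by (simp add: real(2) field_simps ennreal_leI)
    qed
  qed simp
  with f show "Vector_Spaces.linear smul (*) f \<and> (\<forall>x. ennreal (norm (f x)) \<le> enorm x)"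
    by blast
next
  assume "Vector_Spaces.linear smul (*) f \<and> (\<forall>x. ennreal (norm (f x)) \<le> enorm x)"
  then have f: "Vector_Spaces.linear smul (*) f" and le: "\<And>x. ennreal (norm (f x)) \<le> enorm x"
    by auto
  have "openin (enorm_topology UNIV enorm) {x. f x \<in> U}" if "open U" for U
  proof -
    have "\<exists>r>0. \<forall>y. enorm (y - x) < ennreal r \<longrightarrow> f y \<in> U" if x: "f x \<in> U" for x
    proof -
      obtain r where r: "0 < r" "\<And>z. dist z (f x) < r \<Longrightarrow> z \<in> U"
        using \<open>open U\<close> x unfolding open_dist by blast
      have "f y \<in> U" if "enorm (y - x) < ennreal r" for y
      proof (rule r(2))
        have "ennreal (norm (f (y - x))) < ennreal r"
          using le that by (rule le_less_trans)
        then show "dist (f y) (f x) < r"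
          using r(1) by (simp add: ennreal_less_iff linear_functionalD(4)[OF f] dist_norm)
      qed
      with r(1) show ?thesis
        by blast
    qed
    then show ?thesis
      unfolding openin_enorm_topology by simp
  qed
  then have "f \<in> dual_space smul enorm"
    using f by (simp add: dual_space_def continuous_map_def topspace_enorm_topology)
  moreover have "op_norm enorm f \<le> 1"
    unfolding op_norm_def
  proof (rule SUP_least)
    fix x assume "x \<in> {x. enorm x \<le> 1}"
    then show "ennreal (norm (f x)) \<le> 1"
      using le[of x] by (auto simp del: ennreal_le_1 intro: order_trans)
  qed
  ultimately show "f \<in> dual_ball"
    by (simp add: dual_unit_ball_def)
qed

lemma
  assumes "f \<in> dual_ball"
  shows dual_ball_linear: "Vector_Spaces.linear smul (*) f"
    and dual_ball_le: "ennreal (norm (f x)) \<le> enorm x"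
  using assms by (auto simp: mem_dual_ball_iff)

lemma dual_ball_subset: "dual_ball \<subseteq> dual_space smul enorm"
  by (auto simp: dual_unit_ball_def)

lemma topspace_weak_star_ball [simp]: "topspace weak_star_ball = dual_ball"
  using dual_ball_subset by (auto simp: weak_star_topology_def)

lemma openin_weak_star_ballD:
  assumes "openin weak_star_ball U" "f \<in> U"
  obtains F e where "finite F" "0 < e" "{g \<in> dual_ball. \<forall>x\<in>F. norm (g x - f x) < e} \<subseteq> U"
proof -
  obtain W where W: "openin (weak_star_topology smul enorm) W" "U = W \<inter> dual_ball"
    using assms(1) by (auto simp: openin_subtopology)
  then have "f \<in> W"
    using assms(2) by simp
  with W(1)[unfolded weak_star_topology_def] obtain F e where F: "finite F" "F \<subseteq> range (\<lambda>x f. norm (f x))" "0 < e"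
    "{g \<in> dual_space smul enorm. \<forall>p\<in>F. p (g - f) < e} \<subseteq> W"
  proof (rule openin_seminorm_topologyD)
    show "p (f - h) \<le> p (f - g) + p (g - h)"
      if "p \<in> range (\<lambda>x f. norm (f x))" for p and f g h :: "'x \<Rightarrow> 'k"
      using that norm_triangle_ineq[of "f x - g x" "g x - h x" for x] by auto
  qed
  obtain F0 where F0: "finite F0" "F = (\<lambda>x f. norm (f x)) ` F0"
    using finite_subset_image[OF F(1,2)] by blast
  have "{g \<in> dual_ball. \<forall>x\<in>F0. norm (g x - f x) < e} \<subseteq> U"
    using F(4) W(2) dual_ball_subset unfolding F0(2) by auto
  with F0(1) F(3) show ?thesis
    by (rule that)
qed

lemma openin_weak_star_ball_eval:
  assumes "0 < e" "f \<in> dual_ball"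
  shows "openin weak_star_ball {g \<in> dual_ball. norm (g x - f x) < e}"
proof -
  have "openin (weak_star_topology smul enorm) {g \<in> dual_space smul enorm. norm ((g - f) x) < e}"
    unfolding weak_star_topology_def
    by (rule openin_seminorm_ball[of "\<lambda>f. norm (f x)"]) (use assms dual_ball_subset in auto)
  moreover have "{g \<in> dual_ball. norm (g x - f x) < e} = {g \<in> dual_space smul enorm. norm ((g - f) x) < e} \<inter> dual_ball"
    using dual_ball_subset by auto
  ultimately show ?thesis
    by (auto simp: openin_subtopology)
qed

text \<open>Each member of a countable base of neighbourhoods of \<open>0\<close> restricts only finitely many values of a
  functional. A functional in the ball that vanishes at these countably many points belongs to
  every neighbourhood of \<open>0\<close> and is therefore \<open>0\<close>.\<close>

lemma metrizable_imp_countable_total: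
  assumes "metrizable_space weak_star_ball"
  obtains D where "countable D" "\<And>f x. f \<in> dual_ball \<Longrightarrow> (\<And>d. d \<in> D \<Longrightarrow> f d = 0) \<Longrightarrow> f x = 0"
proof -
  define z :: "'x \<Rightarrow> 'k" where "z = (\<lambda>x. 0)"
  have z: "z \<in> dual_ball"
    unfolding mem_dual_ball_iff z_def by (auto intro: linear_functionalI)
  have "first_countable weak_star_ball"
    using assms by (rule metrizable_imp_first_countable)
  then obtain \<B> where \<B>: "countable \<B>" "\<And>V. V \<in> \<B> \<Longrightarrow> openin weak_star_ball V"
    "\<And>U. openin weak_star_ball U \<Longrightarrow> z \<in> U \<Longrightarrow> \<exists>V\<in>\<B>. z \<in> V \<and> V \<subseteq> U"
    using z unfolding first_countable_def by (metis topspace_weak_star_ball)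
  have "\<exists>F. finite F \<and> (\<forall>g\<in>dual_ball. (\<forall>x\<in>F. g x = 0) \<longrightarrow> g \<in> V)" if V: "V \<in> \<B>" "z \<in> V" for V
  proof -
    obtain F e where "finite F" "0 < e" "{g \<in> dual_ball. \<forall>x\<in>F. norm (g x - z x) < e} \<subseteq> V"
      using openin_weak_star_ballD[OF \<B>(2) V(2)] V(1) by blast
    then show ?thesis
      by (intro exI[of _ F]) (auto simp: z_def)
  qed
  then obtain F where F: "\<And>V. V \<in> \<B> \<Longrightarrow> z \<in> V \<Longrightarrow> finite (F V)"
    "\<And>V g. V \<in> \<B> \<Longrightarrow> z \<in> V \<Longrightarrow> g \<in> dual_ball \<Longrightarrow> (\<And>x. x \<in> F V \<Longrightarrow> g x = 0) \<Longrightarrow> g \<in> V"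
    by metis
  define D where "D = (\<Union>V\<in>{V \<in> \<B>. z \<in> V}. F V)"
  have "countable D"
    unfolding D_def using \<B>(1) F(1) by (intro countable_UN) (auto intro: countable_finite)
  moreover have "f x = 0" if f: "f \<in> dual_ball" and fD: "\<And>d. d \<in> D \<Longrightarrow> f d = 0" for f x
  proof (rule ccontr)
    assume "f x \<noteq> 0"
    then have "openin weak_star_ball {g \<in> dual_ball. norm (g x - z x) < norm (f x)}"
      by (intro openin_weak_star_ball_eval z) simp
    moreover have "z \<in> {g \<in> dual_ball. norm (g x - z x) < norm (f x)}"
      using z \<open>f x \<noteq> 0\<close> by simp
    ultimately obtain V where V: "V \<in> \<B>" "z \<in> V" "V \<subseteq> {g \<in> dual_ball. norm (g x - z x) < norm (f x)}"
      using \<B>(3) by blast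
    have "f \<in> V"
    proof (rule F(2)[OF V(1,2) f])
      show "f x = 0" if "x \<in> F V" for x
        using V(1,2) that by (intro fD) (auto simp: D_def)
    qed
    then show False
      using V(3) by (auto simp: z_def)
  qed
  ultimately show ?thesis
    by (rule that)
qed

text \<open>If \<open>x\<close> had positive \<open>p\<close>-distance to the span, the Hahn-Banach theorem for the distance seminorm would
  give a functional that vanishes on \<open>D\<close> but not at \<open>x\<close>; as \<open>p\<close> is dominated, a multiple of it lies in
  the dual ball, where \<open>D\<close> is total.\<close>

lemma total_imp_span_dense:
  assumes total: "\<And>f x. f \<in> dual_ball \<Longrightarrow> (\<And>d. d \<in> D \<Longrightarrow> f d = 0) \<Longrightarrow> f x = 0"
    and p: "dominated_seminorm p" and e: "0 < e"
  shows "\<exists>y\<in>span D. p (x - y) < e"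
proof (rule ccontr)
  assume "\<not> (\<exists>y\<in>span D. p (x - y) < e)"
  then have far: "e \<le> p (x - y)" if "y \<in> span D" for y
    using that by force
  note sp = dominated_imp_seminorm[OF p]
  define q where "q = (\<lambda>x. INF y\<in>span D. p (x - y))"
  have q: "seminorm smul q" and q_le: "\<And>x y. y \<in> span D \<Longrightarrow> q x \<le> p (x - y)"
    unfolding q_def by (rule quotient_seminorm[OF sp subspace_span])+
  have "e \<le> q x"
    unfolding q_def by (rule cINF_greatest) (use far span_zero in auto)
  with e have "q x \<noteq> 0"
    by simp
  then obtain f :: "'x \<Rightarrow> 'k" where f: "Vector_Spaces.linear smul (*) f" "\<And>x. norm (f x) \<le> q x" "f x \<noteq> 0"
    using Hahn_Banach_seminorm[OF q] by blast
  obtain c where c: "0 < c" "\<And>x. ennreal (p x) \<le> ennreal c * enorm x"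
    using p unfolding dominated_seminorm_def by blast
  define g where "g = (\<lambda>x. of_real (inverse c) * f x)"
  have "g \<in> dual_ball"
    unfolding mem_dual_ball_iff
  proof (intro conjI allI)
    show "Vector_Spaces.linear smul (*) g"
      unfolding g_def
      by (rule linear_functionalI) (simp_all add: linear_functionalD[OF f(1)] algebra_simps)
    fix x
    have "norm (f x) \<le> p x"
      using f(2)[of x] q_le[OF span_zero, of x] by simp
    then have "norm (g x) \<le> inverse c * p x"
      using c(1) unfolding g_def norm_mult norm_of_real by (simp add: mult_left_mono)
    then have "ennreal (norm (g x)) \<le> ennreal (inverse c) * ennreal (p x)"
      using c(1) seminorm_nonneg[OF sp, of x] by (simp add: ennreal_leI flip: ennreal_mult)
    also have "\<dots> \<le> ennreal (inverse c) * (ennreal c * enorm x)"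
      by (intro mult_left_mono c(2)) simp
    also have "\<dots> = enorm x"
      using c(1) by (simp flip: mult.assoc ennreal_mult)
    finally show "ennreal (norm (g x)) \<le> enorm x" .
  qed
  moreover have "g d = 0" if "d \<in> D" for d
  proof -
    have "q d \<le> 0"
      using q_le[OF span_base[OF that], of d] seminorm_zero[OF sp] by simp
    with f(2)[of d] have "norm (f d) \<le> 0"
      by (rule order_trans)
    then show ?thesis
      by (simp add: g_def)
  qed
  ultimately have "g x = 0"
    by (rule total)
  then show False
    using f(3) c(1) by (simp add: g_def)
qed

lemma metrizable_imp_separable_flc_topology:
  assumes "metrizable_space weak_star_ball"
  shows "separable_space (flc_topology smul enorm)"
proof -
  obtain D where D: "countable D" "\<And>f x. f \<in> dual_ball \<Longrightarrow> (\<And>d. d \<in> D \<Longrightarrow> f d = 0) \<Longrightarrow> f x = 0"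
    using metrizable_imp_countable_total[OF assms] by blast
  obtain C where C: "countable C"
    "\<And>x p e. x \<in> span D \<Longrightarrow> seminorm smul p \<Longrightarrow> 0 < e \<Longrightarrow> \<exists>c\<in>C. p (c - x) < e"
    using countable_dense_in_span[OF D(1)] by blast
  have "\<exists>c\<in>C. p (c - x) < e" if p: "dominated_seminorm p" and e: "0 < e" for x p e
  proof -
    note sp = dominated_imp_seminorm[OF p]
    have "\<exists>y\<in>span D. p (x - y) < e / 2"
    proof (rule total_imp_span_dense[OF _ p])
      show "f x = 0" if "f \<in> dual_ball" "\<And>d. d \<in> D \<Longrightarrow> f d = 0" for f x
        using that by (rule D(2))
    qed (use e in simp)
    then obtain y where y: "y \<in> span D" "p (x - y) < e / 2"
      by blast
    obtain c where "c \<in> C" "p (c - y) < e / 2"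
      using C(2)[OF y(1) sp, of "e / 2"] e by auto
    then show ?thesis
      using y(2) seminorm_triangle[OF sp, of c x y] seminorm_minus[OF sp, of "x - y"]
      by (intro bexI[of _ c]) auto
  qed
  then have "separable_space (subtopology (flc_topology smul enorm) UNIV)"
    unfolding separable_flc_topology_iff using C(1) by blast
  then show ?thesis
    by simp
qed

text \<open>Evaluation at \<open>x\<close> is uniformly continuous on the dual ball for the uniformity of pointwise
  convergence on \<open>D\<close>. Once this holds for all \<open>x\<close>, the values on \<open>D\<close> determine the weak* topology.\<close>

definition uniformly_determined :: "'x set \<Rightarrow> 'x \<Rightarrow> bool" where
  "uniformly_determined D x \<longleftrightarrow>
     (\<forall>e>0. \<exists>G \<delta>. finite G \<and> G \<subseteq> D \<and> 0 < \<delta> \<and>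
        (\<forall>f\<in>dual_ball. \<forall>g\<in>dual_ball. (\<forall>d\<in>G. norm (f d - g d) < \<delta>) \<longrightarrow> norm (f x - g x) < e))"

lemma uniformly_determinedE:
  assumes "uniformly_determined D x" "0 < e"
  obtains G \<delta> where "finite G" "G \<subseteq> D" "0 < \<delta>"
    "\<And>f g. f \<in> dual_ball \<Longrightarrow> g \<in> dual_ball \<Longrightarrow> (\<And>d. d \<in> G \<Longrightarrow> norm (f d - g d) < \<delta>) \<Longrightarrow> norm (f x - g x) < e"
  using assms unfolding uniformly_determined_def by metis

lemma uniformly_determined_base: "d \<in> D \<Longrightarrow> uniformly_determined D d"
  unfolding uniformly_determined_def by (auto intro!: exI[of _ "{d}"])

lemma subspace_uniformly_determined: "subspace {x. uniformly_determined D x}"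
proof (rule subspaceI; unfold mem_Collect_eq)
  show "uniformly_determined D 0"
    unfolding uniformly_determined_def
    by (auto intro!: exI[of _ "{}"] exI[of _ "1::real"] simp: linear_functionalD(3)[OF dual_ball_linear])
  show "uniformly_determined D (x + y)" if x: "uniformly_determined D x" and y: "uniformly_determined D y" for x y
    unfolding uniformly_determined_def
  proof (intro allI impI)
    fix e :: real assume "0 < e"
    then have e2: "0 < e / 2"
      by simp
    obtain G \<delta> where G: "finite G" "G \<subseteq> D" "0 < \<delta>"
      "\<And>f g. f \<in> dual_ball \<Longrightarrow> g \<in> dual_ball \<Longrightarrow> (\<And>d. d \<in> G \<Longrightarrow> norm (f d - g d) < \<delta>) \<Longrightarrow> norm (f x - g x) < e / 2"
      using uniformly_determinedE[OF x e2] by blast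
    obtain H \<eta> where H: "finite H" "H \<subseteq> D" "0 < \<eta>"
      "\<And>f g. f \<in> dual_ball \<Longrightarrow> g \<in> dual_ball \<Longrightarrow> (\<And>d. d \<in> H \<Longrightarrow> norm (f d - g d) < \<eta>) \<Longrightarrow> norm (f y - g y) < e / 2"
      using uniformly_determinedE[OF y e2] by blast
    have "norm (f (x + y) - g (x + y)) < e"
      if f: "f \<in> dual_ball" and g: "g \<in> dual_ball" and close: "\<forall>d\<in>G \<union> H. norm (f d - g d) < min \<delta> \<eta>" for f g
    proof -
      have "norm (f x - g x) < e / 2"
        by (rule G(4)[OF f g]) (use close in simp)
      moreover have "norm (f y - g y) < e / 2"
        by (rule H(4)[OF f g]) (use close in simp)
      moreover have "f (x + y) - g (x + y) = (f x - g x) + (f y - g y)"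
        by (simp add: linear_functionalD(1)[OF dual_ball_linear] f g)
      ultimately show ?thesis
        using norm_triangle_ineq[of "f x - g x" "f y - g y"] by simp
    qed
    then show "\<exists>G \<delta>. finite G \<and> G \<subseteq> D \<and> 0 < \<delta> \<and> (\<forall>f\<in>dual_ball. \<forall>g\<in>dual_ball.
        (\<forall>d\<in>G. norm (f d - g d) < \<delta>) \<longrightarrow> norm (f (x + y) - g (x + y)) < e)"
      using G H by (intro exI[of _ "G \<union> H"] exI[of _ "min \<delta> \<eta>"]) auto
  qed
  show "uniformly_determined D (smul a x)" if x: "uniformly_determined D x" for a x
    unfolding uniformly_determined_def
  proof (intro allI impI)
    fix e :: real assume e: "0 < e"
    have a: "0 < norm a + 1"
      using norm_ge_zero[of a] by linarith
    with e have "0 < e / (norm a + 1)"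
      by simp
    then obtain G \<delta> where G: "finite G" "G \<subseteq> D" "0 < \<delta>"
      "\<And>f g. f \<in> dual_ball \<Longrightarrow> g \<in> dual_ball \<Longrightarrow> (\<And>d. d \<in> G \<Longrightarrow> norm (f d - g d) < \<delta>) \<Longrightarrow> norm (f x - g x) < e / (norm a + 1)"
      using uniformly_determinedE[OF x] by blast
    have "norm (f (smul a x) - g (smul a x)) < e"
      if f: "f \<in> dual_ball" and g: "g \<in> dual_ball" and close: "\<forall>d\<in>G. norm (f d - g d) < \<delta>" for f g
    proof -
      have "f (smul a x) - g (smul a x) = a * (f x - g x)"
        by (simp add: linear_functionalD(2)[OF dual_ball_linear] f g right_diff_distrib)
      then have "norm (f (smul a x) - g (smul a x)) \<le> (norm a + 1) * norm (f x - g x)"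
        by (simp add: norm_mult mult_right_mono)
      also have "\<dots> < e"
        using G(4)[OF f g] close a by (simp add: field_simps)
      finally show ?thesis .
    qed
    then show "\<exists>G \<delta>. finite G \<and> G \<subseteq> D \<and> 0 < \<delta> \<and> (\<forall>f\<in>dual_ball. \<forall>g\<in>dual_ball.
        (\<forall>d\<in>G. norm (f d - g d) < \<delta>) \<longrightarrow> norm (f (smul a x) - g (smul a x)) < e)"
      using G(1-3) by blast
  qed
qed

text \<open>Functionals in the ball are \<open>1\<close>-Lipschitz for the extended norm, so a point of \<open>D\<close> within \<open>e / 3\<close> of \<open>x\<close>
  controls the value at \<open>x\<close> by an \<open>e / 3\<close> argument.\<close>

lemma uniformly_determined_limit:
  assumes "\<And>r. 0 < r \<Longrightarrow> \<exists>d\<in>D. enorm (d - x) < ennreal r"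
  shows "uniformly_determined D x"
  unfolding uniformly_determined_def
proof (intro allI impI)
  fix e :: real assume e: "0 < e"
  then obtain d where d: "d \<in> D" "enorm (d - x) < ennreal (e / 3)"
    using assms[of "e / 3"] by auto
  have near: "norm (f d - f x) < e / 3" if f: "f \<in> dual_ball" for f
  proof -
    have "ennreal (norm (f (d - x))) < ennreal (e / 3)"
      using dual_ball_le[OF f] d(2) by (rule le_less_trans)
    then show ?thesis
      using e by (simp add: ennreal_less_iff linear_functionalD(4)[OF dual_ball_linear[OF f]])
  qed
  have "norm (f x - g x) < e"
    if f: "f \<in> dual_ball" and g: "g \<in> dual_ball" and "norm (f d - g d) < e / 3" for f g
  proof -
    have "norm (f x - g x) \<le> norm (f d - f x) + norm (f d - g d) + norm (g d - g x)"
      using norm_triangle_ineq4[of "f d - g d" "f d - f x"]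
        norm_triangle_ineq[of "(f d - g d) - (f d - f x)" "g d - g x"] by (simp add: algebra_simps)
    then show ?thesis
      using near[OF f] near[OF g] that(3) by linarith
  qed
  then show "\<exists>G \<delta>. finite G \<and> G \<subseteq> D \<and> 0 < \<delta> \<and> (\<forall>f\<in>dual_ball. \<forall>g\<in>dual_ball.
      (\<forall>d\<in>G. norm (f d - g d) < \<delta>) \<longrightarrow> norm (f x - g x) < e)"
    using d(1) e by (intro exI[of _ "{d}"] exI[of _ "e / 3"]) auto
qed

lemma uniformly_determined_finite:
  assumes "finite F" "\<And>x. uniformly_determined D x" "0 < e"
  obtains G \<delta> where "finite G" "G \<subseteq> D" "0 < \<delta>"
    "\<And>f g x. f \<in> dual_ball \<Longrightarrow> g \<in> dual_ball \<Longrightarrow> (\<And>d. d \<in> G \<Longrightarrow> norm (f d - g d) < \<delta>) \<Longrightarrow> x \<in> F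
      \<Longrightarrow> norm (f x - g x) < e"
proof -
  have "\<exists>G \<delta>. finite G \<and> G \<subseteq> D \<and> 0 < \<delta> \<and> (\<forall>f\<in>dual_ball. \<forall>g\<in>dual_ball.
      (\<forall>d\<in>G. norm (f d - g d) < \<delta>) \<longrightarrow> (\<forall>x\<in>F. norm (f x - g x) < e))"
    using assms(1)
  proof induction
    case empty
    show ?case
      by (intro exI[of _ "{}"] exI[of _ "1::real"]) auto
  next
    case (insert x F)
    then obtain G \<delta> where G: "finite G" "G \<subseteq> D" "0 < \<delta>" "\<forall>f\<in>dual_ball. \<forall>g\<in>dual_ball.
        (\<forall>d\<in>G. norm (f d - g d) < \<delta>) \<longrightarrow> (\<forall>x\<in>F. norm (f x - g x) < e)"
      by blast
    obtain H \<eta> where H: "finite H" "H \<subseteq> D" "0 < \<eta>"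
      "\<And>f g. f \<in> dual_ball \<Longrightarrow> g \<in> dual_ball \<Longrightarrow> (\<And>d. d \<in> H \<Longrightarrow> norm (f d - g d) < \<eta>) \<Longrightarrow> norm (f x - g x) < e"
      using uniformly_determinedE[OF assms(2,3)] by blast
    show ?case
    proof (intro exI[of _ "G \<union> H"] exI[of _ "min \<delta> \<eta>"] conjI ballI impI)
      fix f g y assume f: "f \<in> dual_ball" and g: "g \<in> dual_ball"
        and close: "\<forall>d\<in>G \<union> H. norm (f d - g d) < min \<delta> \<eta>" and y: "y \<in> insert x F"
      have "norm (f x - g x) < e"
        using close by (intro H(4)[OF f g]) simp
      moreover have "\<forall>d\<in>G. norm (f d - g d) < \<delta>"
        using close by simp
      then have "\<forall>x\<in>F. norm (f x - g x) < e"
        using G(4) f g by blast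
      ultimately show "norm (f y - g y) < e"
        using y by blast
    qed (use G(1-3) H(1-3) in auto)
  qed
  then show ?thesis
    using that by metis
qed

text \<open>Restriction to \<open>D\<close> embeds the ball into a countable power of the scalar field, which is metrizable.\<close>

lemma uniformly_determined_imp_metrizable:
  assumes D: "countable D" and det: "\<And>x. uniformly_determined D x"
  shows "metrizable_space weak_star_ball"
proof -
  let ?K = "product_topology (\<lambda>_. euclidean :: 'k topology) D"
  define E :: "('x \<Rightarrow> 'k) \<Rightarrow> 'x \<Rightarrow> 'k" where "E = (\<lambda>f. restrict f D)"
  let ?S = "subtopology ?K (E ` dual_ball)"
  have E_ext: "E f \<in> extensional D" for f
    by (simp add: E_def)
  have S: "topspace ?S = E ` dual_ball"
    using E_ext by (auto simp: topspace_product_topology PiE_def)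
  have eval: "continuous_map weak_star_ball euclidean (\<lambda>f. f d)" for d
    unfolding continuous_map_def
  proof (intro conjI allI impI)
    fix U :: "'k set" assume "openin euclidean U"
    then have U: "open U"
      by simp
    show "openin weak_star_ball {f \<in> topspace weak_star_ball. f d \<in> U}"
    proof (subst openin_subopen, intro ballI)
      fix f assume "f \<in> {f \<in> topspace weak_star_ball. f d \<in> U}"
      then have f: "f \<in> dual_ball" "f d \<in> U"
        by simp_all
      obtain e where e: "0 < e" "\<And>y. dist y (f d) < e \<Longrightarrow> y \<in> U"
        using U f(2) unfolding open_dist by blast
      have "f \<in> {g \<in> dual_ball. norm (g d - f d) < e}"
        using f(1) e(1) by simp
      moreover have "{g \<in> dual_ball. norm (g d - f d) < e} \<subseteq> {f \<in> topspace weak_star_ball. f d \<in> U}"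
        using e(2) unfolding topspace_weak_star_ball by (auto simp: dist_norm)
      ultimately show "\<exists>T. openin weak_star_ball T \<and> f \<in> T \<and> T \<subseteq> {f \<in> topspace weak_star_ball. f d \<in> U}"
        using openin_weak_star_ball_eval[OF e(1) f(1)] by blast
    qed
  qed auto
  have "homeomorphic_map weak_star_ball ?S E"
  proof (rule bijective_open_imp_homeomorphic_map)
    show "continuous_map weak_star_ball ?S E"
      unfolding continuous_map_in_subtopology continuous_map_componentwise
    proof (intro conjI ballI)
      show "continuous_map weak_star_ball euclidean (\<lambda>f. E f d)" if "d \<in> D" for d
        using eval[of d] that by (simp add: E_def)
    qed (use E_ext in auto)
    show "open_map weak_star_ball ?S E"
      unfolding open_map_def
    proof (intro allI impI)
      fix U assume U: "openin weak_star_ball U"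
      show "openin ?S (E ` U)"
      proof (subst openin_subopen, intro ballI)
        fix s assume "s \<in> E ` U"
        then obtain f where f: "f \<in> U" "s = E f"
          by blast
        have fB: "f \<in> dual_ball"
          using openin_subset[OF U] f(1) by auto
        obtain F e where F: "finite F" "0 < e" "{g \<in> dual_ball. \<forall>x\<in>F. norm (g x - f x) < e} \<subseteq> U"
          using openin_weak_star_ballD[OF U f(1)] by blast
        obtain G \<delta> where G: "finite G" "G \<subseteq> D" "0 < \<delta>"
          "\<And>f g x. f \<in> dual_ball \<Longrightarrow> g \<in> dual_ball \<Longrightarrow> (\<And>d. d \<in> G \<Longrightarrow> norm (f d - g d) < \<delta>) \<Longrightarrow> x \<in> F
            \<Longrightarrow> norm (f x - g x) < e"
          using uniformly_determined_finite[OF F(1) det F(2)] by blast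
        (* A basic open box of the product around E f that only constrains the coordinates in G. *)
        define X where "X = (\<lambda>d. if d \<in> G then ball (f d) \<delta> else UNIV)"
        have "openin ?K (Pi\<^sub>E D X)"
        proof (rule product_topology_basis)
          show "finite {d. X d \<noteq> topspace euclidean}"
            by (rule finite_subset[OF _ G(1)]) (auto simp: X_def)
        qed (simp add: X_def)
        then have "openin ?S (Pi\<^sub>E D X \<inter> E ` dual_ball)"
          unfolding openin_subtopology by blast
        moreover have "s \<in> Pi\<^sub>E D X \<inter> E ` dual_ball"
          using f(2) fB G(3) by (auto simp: X_def E_def)
        moreover have "Pi\<^sub>E D X \<inter> E ` dual_ball \<subseteq> E ` U"
        proof
          fix t assume "t \<in> Pi\<^sub>E D X \<inter> E ` dual_ball"
          then obtain g where g: "g \<in> dual_ball" "t = E g" "E g \<in> Pi\<^sub>E D X"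
            by auto
          have "norm (g d - f d) < \<delta>" if "d \<in> G" for d
          proof -
            have "E g d \<in> X d"
              using g(3) that G(2) by (auto dest: PiE_mem)
            then show ?thesis
              using that G(2) by (auto simp: X_def E_def dist_norm norm_minus_commute)
          qed
          then have "norm (g x - f x) < e" if "x \<in> F" for x
            using G(4)[OF g(1) fB _ that] by blast
          then have "g \<in> U"
            using F(3) g(1) by blast
          then show "t \<in> E ` U"
            using g(2) by blast
        qed
        ultimately show "\<exists>T. openin ?S T \<and> s \<in> T \<and> T \<subseteq> E ` U"
          by blast
      qed
    qed
    show "E ` topspace weak_star_ball = topspace ?S"
      by (simp only: S topspace_weak_star_ball)
    show "inj_on E (topspace weak_star_ball)"
    proof (rule inj_onI)
      fix f g assume fg: "f \<in> topspace weak_star_ball" "g \<in> topspace weak_star_ball" and eq: "E f = E g"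
      have D_eq: "f d = g d" if "d \<in> D" for d
        using fun_cong[OF eq, of d] that by (simp add: E_def)
      have small: "norm (f x - g x) < e" if e: "0 < e" for x e
      proof -
        obtain G \<delta> where G: "finite G" "G \<subseteq> D" "0 < \<delta>"
          "\<And>f g. f \<in> dual_ball \<Longrightarrow> g \<in> dual_ball \<Longrightarrow> (\<And>d. d \<in> G \<Longrightarrow> norm (f d - g d) < \<delta>) \<Longrightarrow> norm (f x - g x) < e"
          using uniformly_determinedE[OF det[of x] e] by blast
        show ?thesis
        proof (rule G(4))
          show "norm (f d - g d) < \<delta>" if "d \<in> G" for d
            using D_eq[of d] G(2,3) that by auto
        qed (use fg in \<open>simp_all only: topspace_weak_star_ball\<close>)
      qed
      show "f = g"
      proof
        show "f x = g x" for x
          using small[of "norm (f x - g x)" x] by auto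
      qed
    qed
  qed
  then have "weak_star_ball homeomorphic_space ?S"
    by (rule homeomorphic_map_imp_homeomorphic_space)
  moreover have "metrizable_space ?K"
    unfolding metrizable_space_product_topology using D metrizable_space_euclidean by auto
  then have "metrizable_space ?S"
    by (rule metrizable_space_subtopology)
  ultimately show ?thesis
    using homeomorphic_metrizable_space by blast
qed

section \<open>The direct sum decomposition\<close>

text \<open>This is why \<open>\<tau>\<^sub>F\<close> restricts to the finest of all locally convex topologies on \<open>M\<close>: every seminorm
  on \<open>M\<close>, composed with the projection along the finite vectors, is dominated.\<close>

lemma dominated_seminorm_vanishing:
  assumes p: "seminorm smul p" and "\<And>x. x \<in> fin_subspace enorm \<Longrightarrow> p x = 0"
  shows "dominated_seminorm p"
  unfolding dominated_seminorm_def
proof (intro conjI p exI[of _ "1::real"] allI)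
  show "ennreal (p x) \<le> ennreal 1 * enorm x" for x
    using assms(2)[of x] by (cases "enorm x = \<infinity>") (auto simp: fin_subspace_def less_top)
qed simp

text \<open>Both projections of the direct sum are continuous from \<open>\<tau>\<^sub>F\<close>, so they carry a countable dense set to
  countable dense sets. Along the finite vectors this holds because a dominated seminorm composed with
  the projection to \<open>M\<close> vanishes on them; along \<open>M\<close> because the norm of the finite component is itself a
  dominated seminorm.\<close>

lemma separable_flc_topology_summands:
  assumes dec: "direct_sum_decomposition smul (fin_subspace enorm) M"
    and sep: "separable_space (flc_topology smul enorm)"
  shows "separable_space (subtopology (flc_topology smul enorm) M)"
    and "separable_space (enorm_topology (fin_subspace enorm) enorm)"
proof -
  obtain \<pi> where \<pi>: "\<And>x. \<pi> x \<in> fin_subspace enorm" "\<And>x. x - \<pi> x \<in> M"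
    "\<And>x y. \<pi> (x + y) = \<pi> x + \<pi> y" "\<And>a x. \<pi> (smul a x) = smul a (\<pi> x)"
    "\<And>v. v \<in> fin_subspace enorm \<Longrightarrow> \<pi> v = v" "\<And>w. w \<in> M \<Longrightarrow> \<pi> w = 0"
    using direct_sum_projection[OF dec] by blast
  have \<pi>_diff: "\<pi> (x - y) = \<pi> x - \<pi> y" for x y
    using \<pi>(3)[of "x - y" y] by simp
  have "separable_space (subtopology (flc_topology smul enorm) UNIV)"
    using sep by simp
  then obtain D where D: "countable D"
    "\<And>x p e. dominated_seminorm p \<Longrightarrow> 0 < e \<Longrightarrow> \<exists>d\<in>D. p (d - x) < e"
    unfolding separable_flc_topology_iff by blast
  show "separable_space (subtopology (flc_topology smul enorm) M)"
    unfolding separable_flc_topology_iff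
  proof (intro exI[of _ "(\<lambda>d. d - \<pi> d) ` D"] conjI ballI allI impI)
    fix x p and e :: real assume x: "x \<in> M" and p: "dominated_seminorm p" and e: "0 < e"
    note sp = dominated_imp_seminorm[OF p]
    let ?q = "\<lambda>x. p (x - \<pi> x)"
    have "dominated_seminorm ?q"
    proof (rule dominated_seminorm_vanishing)
      show "seminorm smul ?q"
        unfolding seminorm_def
      proof (intro conjI allI)
        show "p (x + y - \<pi> (x + y)) \<le> p (x - \<pi> x) + p (y - \<pi> y)" for x y
          using seminorm_add[OF sp, of "x - \<pi> x" "y - \<pi> y"] by (simp add: \<pi>(3) algebra_simps)
        show "p (smul a x - \<pi> (smul a x)) = norm a * p (x - \<pi> x)" for a x
          using seminorm_scale[OF sp, of a "x - \<pi> x"] by (simp add: \<pi>(4) scale_right_diff_distrib)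
      qed (rule seminorm_nonneg[OF sp])
    qed (simp add: \<pi>(5) seminorm_zero[OF sp])
    then obtain d where d: "d \<in> D" "p (d - x - \<pi> (d - x)) < e"
      using D(2)[of ?q e x] e by auto
    have eq: "d - x - \<pi> (d - x) = d - \<pi> d - x"
      using x by (simp add: \<pi>_diff \<pi>(6))
    show "\<exists>c\<in>(\<lambda>d. d - \<pi> d) ` D. p (c - x) < e"
      using d unfolding eq by blast
  qed (use D(1) \<pi>(2) in auto)
  show "separable_space (enorm_topology (fin_subspace enorm) enorm)"
    unfolding separable_enorm_topology_iff
  proof (intro exI[of _ "\<pi> ` D"] conjI ballI allI impI)
    fix x and r :: real assume x: "x \<in> fin_subspace enorm" and r: "0 < r"
    let ?q = "\<lambda>x. enn2real (enorm (\<pi> x))"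
    have fin: "enorm (\<pi> x) < \<infinity>" for x
      using \<pi>(1)[of x] by (simp add: fin_subspace_def)
    have q: "ennreal (?q x) = enorm (\<pi> x)" for x
      using fin[of x] by simp
    have "seminorm smul ?q"
      unfolding seminorm_def
    proof (intro conjI allI)
      show "?q (x + y) \<le> ?q x + ?q y" for x y
      proof -
        have "ennreal (?q (x + y)) \<le> ennreal (?q x) + ennreal (?q y)"
          unfolding q unfolding \<pi>(3) by (rule enorm_triangle)
        also have "\<dots> = ennreal (?q x + ?q y)"
          by (rule ennreal_plus[symmetric]) simp_all
        finally show ?thesis
          by (subst (asm) ennreal_le_iff) auto
      qed
      show "?q (smul a x) = norm a * ?q x" for a x
        by (simp add: \<pi>(4) enorm_scale enn2real_mult)
    qed simp
    moreover have "ennreal (?q x) \<le> ennreal 1 * enorm x" for x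
    proof (cases "enorm x = \<infinity>")
      case False
      then have "x \<in> fin_subspace enorm"
        by (simp add: fin_subspace_def less_top)
      then show ?thesis
        unfolding q by (simp add: \<pi>(5))
    qed simp
    ultimately have "dominated_seminorm ?q"
      unfolding dominated_seminorm_def using zero_less_one by blast
    then obtain d where d: "d \<in> D" "?q (d - x) < r"
      using D(2)[of ?q r x] r by auto
    have "enorm (\<pi> d - x) = ennreal (?q (d - x))"
      unfolding q using x by (simp add: \<pi>_diff \<pi>(5))
    also have "\<dots> < ennreal r"
      using d(2) by (simp add: ennreal_less_iff)
    finally show "\<exists>c\<in>\<pi> ` D. enorm (c - x) < ennreal r"
      using d(1) by blast
  qed (use D(1) \<pi>(1) in auto)
qed

text \<open>In the finest locally convex topology every subspace is closed: a point of \<open>M\<close> outside the span of \<open>D\<close>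
  is separated from it by a functional that also vanishes on the finite vectors and is therefore
  \<open>\<tau>\<^sub>F\<close>-continuous. So a dense subset of \<open>M\<close> spans \<open>M\<close>.\<close>

lemma separable_flc_topology_imp_countable_dim:
  assumes dec: "direct_sum_decomposition smul (fin_subspace enorm) M"
    and "separable_space (subtopology (flc_topology smul enorm) M)"
  shows "countable_dim smul M"
proof -
  have M: "subspace M" and inter: "fin_subspace enorm \<inter> M = {0}"
    using dec by (auto simp: direct_sum_decomposition_def)
  obtain D where D: "countable D" "D \<subseteq> M"
    and dense: "\<forall>x\<in>M. \<forall>p e. dominated_seminorm p \<longrightarrow> 0 < e \<longrightarrow> (\<exists>d\<in>D. p (d - x) < e)"
    using assms(2) unfolding separable_flc_topology_iff by blast
  have span_D: "span D \<subseteq> M"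
    using D(2) M by (rule span_minimal)
  have "M \<subseteq> span D"
  proof (rule ccontr)
    assume "\<not> M \<subseteq> span D"
    then obtain x where x: "x \<in> M" "x \<notin> span D"
      by blast
    have "x \<notin> span (fin_subspace enorm \<union> D)"
    proof
      assume "x \<in> span (fin_subspace enorm \<union> D)"
      then obtain v w where vw: "v \<in> span (fin_subspace enorm)" "w \<in> span D" "x = v + w"
        unfolding span_Un by blast
      then have v: "v \<in> fin_subspace enorm"
        using subspace_fin_subspace by (simp add: span_eq_iff[THEN iffD2])
      have "x - w \<in> M"
        using x(1) vw(2) span_D by (intro subspace_diff M) auto
      with v vw(3) have "v \<in> fin_subspace enorm \<inter> M"
        by simp
      with inter have "v = 0"
        by blast
      with vw x(2) show False
        by simp
    qed
    then obtain f :: "'x \<Rightarrow> 'k" where f: "Vector_Spaces.linear smul (*) f"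
      "\<And>s. s \<in> fin_subspace enorm \<union> D \<Longrightarrow> f s = 0" "f x = 1"
      using separating_functional by blast
    have "dominated_seminorm (\<lambda>x. norm (f x))"
      using f(2) by (intro dominated_seminorm_vanishing seminorm_norm_functional f(1)) simp
    then obtain d where "d \<in> D" "norm (f (d - x)) < 1"
      using dense[rule_format, OF x(1), of "\<lambda>x. norm (f x)" 1] by auto
    then show False
      using f(2,3) by (simp add: linear_functionalD(4)[OF f(1)])
  qed
  with span_D have "span D = M"
    by blast
  obtain B where B: "B \<subseteq> D" "independent B" "D \<subseteq> span B"
    by (rule maximal_independent_subset)
  have "span B = M"
    using span_mono[OF B(1)] span_minimal[OF B(3) subspace_span] \<open>span D = M\<close> by blast
  moreover have "countable B"
    using B(1) D(1) by (rule countable_subset)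
  ultimately show ?thesis
    using B(2) unfolding countable_dim_def by blast
qed

text \<open>Take for \<open>D\<close> a countable dense set of finite vectors and for \<open>B\<close> a countable basis of \<open>M\<close>. The points
  determined by \<open>D \<union> B\<close> form a subspace containing both summands.\<close>

lemma countable_dim_imp_metrizable:
  assumes dec: "direct_sum_decomposition smul (fin_subspace enorm) M"
    and "countable_dim smul M" and "separable_space (enorm_topology (fin_subspace enorm) enorm)"
  shows "metrizable_space weak_star_ball"
proof -
  obtain B where B: "span B = M" "countable B"
    using assms(2) unfolding countable_dim_def by blast
  obtain D where D: "countable D"
    "\<And>x r. x \<in> fin_subspace enorm \<Longrightarrow> 0 < r \<Longrightarrow> \<exists>d\<in>D. enorm (d - x) < ennreal r"
    using assms(3) unfolding separable_enorm_topology_iff by blast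
  let ?Z = "{x. uniformly_determined (D \<union> B) x}"
  note Z = subspace_uniformly_determined[of "D \<union> B"]
  have "M \<subseteq> ?Z"
    unfolding B(1)[symmetric] by (rule span_minimal[OF _ Z]) (auto intro: uniformly_determined_base)
  moreover have "fin_subspace enorm \<subseteq> ?Z"
    using D(2) by (auto intro!: uniformly_determined_limit)
  ultimately have sum: "v + w \<in> ?Z" if "v \<in> fin_subspace enorm" "w \<in> M" for v w
    using that by (intro subspace_add Z) auto
  have "uniformly_determined (D \<union> B) x" for x
  proof -
    have "x \<in> {v + w | v w. v \<in> fin_subspace enorm \<and> w \<in> M}"
      using dec by (simp add: direct_sum_decomposition_def)
    then show ?thesis
      using sum by auto
  qed
  then show ?thesis
    using D(1) B(2) by (intro uniformly_determined_imp_metrizable[of "D \<union> B"]) auto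
qed

end

theorem theorem3p9:
  fixes smul :: "'k::real_or_complex \<Rightarrow> 'x::ab_group_add \<Rightarrow> 'x"
    and enorm :: "'x \<Rightarrow> ennreal"
    and M :: "'x set"
  assumes "extended_normed_space smul enorm"
    and "direct_sum_decomposition smul (fin_subspace enorm) M"
  shows
    "(metrizable_space (subtopology (weak_star_topology smul enorm) (dual_unit_ball smul enorm))
       \<longleftrightarrow> countable_dim smul M \<and> separable_space (enorm_topology (fin_subspace enorm) enorm)) \<and>
     (countable_dim smul M \<and> separable_space (enorm_topology (fin_subspace enorm) enorm)
       \<longleftrightarrow> separable_space (subtopology (flc_topology smul enorm) M) \<and>
          separable_space (enorm_topology (fin_subspace enorm) enorm)) \<and>
     (separable_space (subtopology (flc_topology smul enorm) M) \<and>
      separable_space (enorm_topology (fin_subspace enorm) enorm)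
       \<longleftrightarrow> separable_space (flc_topology smul enorm))"
proof -
  interpret extended_normed_space smul enorm
    by (rule assms(1))
  note dec = assms(2)
  show ?thesis
    using metrizable_imp_separable_flc_topology separable_flc_topology_summands[OF dec]
      separable_flc_topology_imp_countable_dim[OF dec] countable_dim_imp_metrizable[OF dec]
    by blast
qed

end
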